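(* Let $\mathbf X(t)$, $t>0$, be the three-dimensional symmetric Markov random flight with speed $c>0$ and switching intensity $\lambda>0$, and let $H(\boldsymbol\alpha,t)=\mathbb E\, e^{i\langle\boldsymbol\alpha,\mathbf X(t)\rangle}$ be its characteristic function. For $\boldsymbol\alpha=(\alpha_1,\alpha_2,\alpha_3)\in\mathbb R^3$, $\Vert\boldsymbol\alpha\Vert=\sqrt{\alpha_1^2+\alpha_2^2+\alpha_3^2}$, the following asymptotic formula holds as $t\to 0$, $t>0$: $$\begin{aligned}H(\boldsymbol\alpha,t)&=e^{-\lambda t}\biggl\{\frac{\sin(ct\Vert\boldsymbol\alpha\Vert)}{ct\Vert\boldsymbol\alpha\Vert}+\frac{\lambda}{c^2t\Vert\boldsymbol\alpha\Vert^2}\Bigl[\sin(ct\Vert\boldsymbol\alpha\Vert)\,\mathrm{Si}(2ct\Vert\boldsymbol\alpha\Vert)+\cos(ct\Vert\boldsymbol\alpha\Vert)\,\mathrm{Ci}(2ct\Vert\boldsymbol\alpha\Vert)\Bigr]\\&\qquad\qquad+\frac{\lambda^2t}{c\Vert\boldsymbol\alpha\Vert}J_1(ct\Vert\boldsymbol\alpha\Vert)+\frac{\lambda^3\sqrt{\pi}\,t^{3/2}}{(2c\Vert\boldsymbol\alpha\Vert)^{3/2}}\,J_{3/2}(ct\Vert\boldsymbol\alpha\Vert)\biggr\}+o(t^3),\end{aligned}$$ where $$\mathrm{Si}(x)=\int_0^x\frac{\sin\xi}{\xi}\,d\xi,\qquad \mathrm{Ci}(x)=\int_0^x\frac{\cos\xi-1}{\xi}\,d\xi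 .$$
   Context: The three-dimensional symmetric Markov random flight $\mathbf X(t)=(X_1(t),X_2(t),X_3(t))$: a particle starts at time $t=0$ from the origin of $\mathbb R^3$ and moves with constant speed $c>0$. Its initial direction is uniformly distributed on the unit sphere $S_1=\{\mathbf x\in\mathbb R^3:\Vert\mathbf x\Vert=1\}$. A homogeneous Poisson process $N(t)$ of rate $\lambda>0$ controls the motion: at each Poisson event the particle instantaneously takes a new random direction, uniformly distributed on $S_1$ and independent of its previous motion, and keeps moving with the same speed $c$ until the next Poisson event, and so on. $\mathbf X(t)$ is the particle's position at time $t$. $J_\nu(z)$ is the Bessel function of the first kind. At $\boldsymbol\alpha=\mathbf 0$ the terms on the right-hand side are understood by continuity. *)

theory Defs
  imports "HOL-Probability.Probability" "HOL-Library.Landau_Symbols"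
begin

section \<open>Poisson processes\<close>

text \<open>
  \<open>N t \<omega>\<close> is the number of events up to time \<open>t \<ge> 0\<close>; values at negative times are irrelevant.
  The topology on \<^typ>\<open>nat\<close> is discrete, so right-continuity says that paths are step functions.
  Since paths are nondecreasing, the truncated subtraction on \<^typ>\<open>nat\<close> gives the true increments.
\<close>

locale poisson_process = prob_space M for M :: "'a measure" +
  fixes rate :: real and N :: "real \<Rightarrow> 'a \<Rightarrow> nat"
  assumes rate_pos: "rate > 0"
    and N_measurable: "\<And>t. t \<ge> 0 \<Longrightarrow> N t \<in> measurable M (count_space UNIV)"
    and N_zero: "\<And>\<omega>. \<omega> \<in> space M \<Longrightarrow> N 0 \<omega> = 0"
    and N_mono: "\<And>\<omega>. \<omega> \<in> space M \<Longrightarrow> mono_on {0..} (\<lambda>t. N t \<omega>)"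
    and N_right_continuous:
      "\<And>\<omega> t. \<omega> \<in> space M \<Longrightarrow> t \<ge> 0 \<Longrightarrow> ((\<lambda>s. N s \<omega>) \<longlongrightarrow> N t \<omega>) (at_right t)"
    and N_increments_poisson:
      "\<And>s t. 0 \<le> s \<Longrightarrow> s < t \<Longrightarrow>
         distr M (count_space UNIV) (\<lambda>\<omega>. N t \<omega> - N s \<omega>) =
         measure_pmf (poisson_pmf (rate * (t - s)))"
    and N_increments_indep:
      "\<And>\<tau> :: nat \<Rightarrow> real. 0 \<le> \<tau> 0 \<Longrightarrow> strict_mono \<tau> \<Longrightarrow>
         indep_vars (\<lambda>_. count_space UNIV) (\<lambda>i \<omega>. N (\<tau> (Suc i)) \<omega> - N (\<tau> i) \<omega>) UNIV"

section \<open>Markov random flights\<close>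

text \<open>
  The uniform distribution on the unit sphere (normalised surface measure), realised as the radial
  projection of the uniform distribution on the unit ball; note \<open>sgn x = x /\<^sub>R norm x\<close>.
\<close>

definition uniform_sphere :: "'v::euclidean_space measure" where
  "uniform_sphere = distr (uniform_measure lborel (ball 0 1)) borel sgn"

text \<open>
  \<open>U 0\<close> is the initial direction and \<open>U k\<close> the direction chosen at the \<open>k\<close>-th Poisson event.
  The last assumption is the independence of the \<open>\<sigma>\<close>-algebras generated by the whole
  process \<open>N\<close> and by the whole sequence \<open>U\<close>.
\<close>

locale markov_random_flight = poisson_process M rate N
  for M :: "'a measure" and rate :: real and N :: "real \<Rightarrow> 'a \<Rightarrow> nat" +
  fixes c :: real and U :: "nat \<Rightarrow> 'a \<Rightarrow> 'v::euclidean_space"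
  assumes speed_pos: "c > 0"
    and U_indep: "indep_vars (\<lambda>_. borel) U UNIV"
    and U_uniform: "\<And>k. distr M borel (U k) = uniform_sphere"
    and N_U_indep:
      "indep_set
         (sets (vimage_algebra (space M) (\<lambda>\<omega>. \<lambda>t\<in>{0..}. N t \<omega>) (\<Pi>\<^sub>M t\<in>{0..}. count_space UNIV)))
         (sets (vimage_algebra (space M) (\<lambda>\<omega> k. U k \<omega>) (\<Pi>\<^sub>M k\<in>UNIV. borel)))"

text \<open>
  At time \<open>s\<close> the velocity is \<open>c\<close> times the direction currently in force; the position is its
  integral. On each path the integrand is piecewise constant with finitely many pieces.
\<close>

definition flight_position ::
  "real \<Rightarrow> (real \<Rightarrow> 'a \<Rightarrow> nat) \<Rightarrow> (nat \<Rightarrow> 'a \<Rightarrow> 'v::euclidean_space) \<Rightarrow> real \<Rightarrow> 'a \<Rightarrow> 'v" where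
  "flight_position c N U t \<omega> = integral {0..t} (\<lambda>s. c *\<^sub>R U (N s \<omega>) \<omega>)"

definition char_fun :: "'a measure \<Rightarrow> ('a \<Rightarrow> 'v::euclidean_space) \<Rightarrow> 'v \<Rightarrow> complex" where
  "char_fun M X \<alpha> = (CLINT \<omega>|M. iexp (\<alpha> \<bullet> X \<omega>))"

section \<open>Special functions\<close>

text \<open>
  The sine integral is \<^const>\<open>Si\<close> from the library. The cosine integral used here is the entire
  one, which differs from the usual one by \<open>ln x\<close> plus Euler's constant.
\<close>

definition Ci :: "real \<Rightarrow> real" where
  "Ci x = (LBINT \<xi>=0..x. (cos \<xi> - 1) / \<xi>)"

text \<open>
  Bessel functions of the first kind of real order, for arguments \<open>x > 0\<close> only
  (as \<open>0 powr a = 0\<close> even for \<open>a = 0\<close>).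
\<close>

definition bessel_J :: "real \<Rightarrow> real \<Rightarrow> real" where
  "bessel_J \<nu> x = (\<Sum>k. (-1) ^ k * rGamma (\<nu> + real k + 1) / fact k * (x / 2) powr (2 * real k + \<nu>))"

section \<open>Extension by continuity to the origin\<close>

definition extend_to_0 ::
  "('v::real_normed_vector \<Rightarrow> 'b::t2_space) \<Rightarrow> 'v \<Rightarrow> 'b" where
  "extend_to_0 f \<alpha> = (if \<alpha> = 0 then Lim (at 0) f else f \<alpha>)"

end

theory Submission
  imports Defs "HOL-Real_Asymp.Real_Asymp"
begin

text \<open>
  Put \<open>Z s = \<alpha> \<bullet> U (N s)\<close>, so that \<open>\<alpha> \<bullet> X t\<close> is \<open>c\<close> times the integral of \<open>Z\<close> over \<open>[0, t]\<close> and
  is bounded by \<open>c * t * norm \<alpha>\<close>. Taylor's formula for \<open>exp (\<i> x)\<close> reduces the characteristic function,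
  up to \<open>O(t\<^sup>4)\<close>, to the first three moments of this integral, with no conditioning on the number of
  Poisson events. The first moment vanishes by symmetry. The third is \<open>O(t\<^sup>4)\<close>, because the odd moments
  of the path without events vanish and an event occurs with probability \<open>O(t)\<close>. The second follows
  exactly from Fubini and
  \<open>E (Z s * Z r) = (norm \<alpha>)\<^sup>2 / d * P (N s = N r) = (norm \<alpha>)\<^sup>2 / d * exp (- \<lambda> * \<bar>s - r\<bar>)\<close>.

  On the other side each term of the formula is a power of \<open>t\<close> times a function of \<open>c * t * norm \<alpha>\<close> that
  is continuous at \<open>0\<close>, and the two expansions agree up to order 3.
\<close>

section \<open>Moments of the uniform distribution on the sphere\<close>

text \<open>\<open>T\<close> is the reflection that exchanges the coordinates along \<open>i\<close>
  and \<open>j\<close>. The preimage of a box is a box with the same side lengths in another order,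
  and volume is their product.\<close>

lemma lborel_distr_swap_Basis:
  fixes i j :: "'v::euclidean_space"
  assumes i: "i \<in> Basis" and j: "j \<in> Basis"
  defines "T \<equiv> \<lambda>x. x - (x \<bullet> i - x \<bullet> j) *\<^sub>R (i - j)"
  shows "distr lborel borel T = lborel"
proof (rule lborel_eqI[symmetric])
  show "sets (distr lborel borel T) = sets borel" by simp
  let ?p = "Transposition.transpose i j"
  have inner_T: "T x \<bullet> b = x \<bullet> ?p b" if "b \<in> Basis" for x b
    using i j that by (auto simp: T_def inner_diff_left inner_Basis Transposition.transpose_def)
  have p: "?p b \<in> Basis" if "b \<in> Basis" for b
    using i j that by (auto simp: Transposition.transpose_def)
  have bij: "bij_betw ?p Basis Basis"
    by (rule bij_betw_byWitness[where f' = ?p]) (auto simp: p)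
  have TT: "T (T x) = x" for x
    by (rule euclidean_eqI) (simp add: inner_T p)
  have T_meas: "T \<in> measurable borel borel"
    unfolding T_def by measurable
  fix l u :: 'v assume le: "\<And>b. b \<in> Basis \<Longrightarrow> l \<bullet> b \<le> u \<bullet> b"
  have "T -` box l u = box (T l) (T u)"
  proof (intro set_eqI iffI)
    fix x assume "x \<in> T -` box l u"
    hence *: "b \<in> Basis \<Longrightarrow> l \<bullet> b < x \<bullet> ?p b \<and> x \<bullet> ?p b < u \<bullet> b" for b
      by (auto simp: mem_box inner_T)
    show "x \<in> box (T l) (T u)"
      using *[OF p] by (auto simp: mem_box inner_T)
  next
    fix x assume "x \<in> box (T l) (T u)"
    hence *: "b \<in> Basis \<Longrightarrow> l \<bullet> ?p b < x \<bullet> b \<and> x \<bullet> b < u \<bullet> ?p b" for b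
      by (auto simp: mem_box inner_T)
    show "x \<in> T -` box l u"
      using *[OF p] by (auto simp: mem_box inner_T)
  qed
  hence "emeasure (distr lborel borel T) (box l u) = emeasure lborel (box (T l) (T u))"
    using T_meas by (subst emeasure_distr) auto
  also have "\<dots> = (\<Prod>b\<in>Basis. (u - l) \<bullet> ?p b)"
    using le p by (subst emeasure_lborel_box) (auto simp: inner_T inner_diff_left)
  also have "(\<Prod>b\<in>Basis. (u - l) \<bullet> ?p b) = (\<Prod>b\<in>Basis. (u - l) \<bullet> b)"
    by (rule prod.reindex_bij_betw[OF bij])
  finally show "emeasure (distr lborel borel T) (box l u) = (\<Prod>b\<in>Basis. (u - l) \<bullet> b)" .
qed

text \<open>Scaling the coordinates by \<open>s b\<close> changes volume by the product of the
  \<open>\<bar>s b\<bar>\<close>, which is 1 here.\<close>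

lemma lborel_distr_sign_change:
  fixes s :: "'v::euclidean_space \<Rightarrow> real"
  assumes "\<And>b. b \<in> Basis \<Longrightarrow> \<bar>s b\<bar> = 1"
  shows "distr lborel borel (\<lambda>x. \<Sum>b\<in>Basis. (s b * (x \<bullet> b)) *\<^sub>R b) = (lborel :: 'v measure)"
proof -
  have "s b \<noteq> 0" if "b \<in> Basis" for b using assms[OF that] by auto
  from lborel_affine_euclidean[of s 0, OF this] show ?thesis
    using assms by (simp add: one_ennreal_def[symmetric] density_1)
qed

text \<open>A linear isometry preserves the unit ball and commutes with \<open>sgn\<close>.
  Invariance of Lebesgue measure thus passes to the uniform law on the ball and then to its radial
  projection.\<close>

lemma distr_uniform_sphere_isometry:
  fixes T :: "'v::euclidean_space \<Rightarrow> 'v"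
  assumes T: "distr lborel borel T = lborel" "orthogonal_transformation T"
  shows "distr uniform_sphere borel T = uniform_sphere"
proof -
  have lin: "linear T" and norm: "norm (T x) = norm x" for x
    using T(2) by (auto simp: orthogonal_transformation)
  have meas[measurable]: "T \<in> measurable borel borel"
    by (intro borel_measurable_continuous_onI linear_continuous_on linear_conv_bounded_linear[THEN iffD1] lin)
  have sgn: "T (sgn x) = sgn (T x)" for x
    using norm by (simp add: sgn_div_norm linear_scale[OF lin])
  have distr_ball: "distr (uniform_measure lborel (ball 0 1)) borel T = uniform_measure lborel (ball 0 1)"
  proof (rule measure_eqI)
    fix A assume "A \<in> sets (distr (uniform_measure lborel (ball 0 1)) borel T)"
    hence A[measurable]: "A \<in> sets borel" by simp
    have "emeasure (distr (uniform_measure lborel (ball 0 1)) borel T) A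
        = emeasure lborel (ball 0 1 \<inter> T -` A) / emeasure lborel (ball (0::'v) 1)"
      by (subst emeasure_distr) (auto simp: measurable_sets_borel[OF meas A])
    also have "ball 0 1 \<inter> T -` A = T -` (ball 0 1 \<inter> A)"
      using norm by auto
    also have "emeasure lborel \<dots> = emeasure (distr lborel borel T) (ball 0 1 \<inter> A)"
      by (subst emeasure_distr) auto
    finally show "emeasure (distr (uniform_measure lborel (ball 0 1)) borel T) A =
        emeasure (uniform_measure lborel (ball 0 1)) A"
      by (simp add: T(1))
  qed simp
  have "distr uniform_sphere borel T = distr (uniform_measure lborel (ball 0 1)) borel (sgn \<circ> T)"
    unfolding uniform_sphere_def by (subst distr_distr) (auto simp: comp_def sgn)
  also have "\<dots> = uniform_sphere"
    unfolding uniform_sphere_def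
    by (subst distr_distr[symmetric, where N = borel]) (simp_all add: distr_ball)
  finally show ?thesis .
qed

lemma sets_uniform_sphere [simp, measurable_cong]: "sets uniform_sphere = sets borel"
  by (simp add: uniform_sphere_def)

lemma space_uniform_sphere [simp]: "space uniform_sphere = UNIV"
  by (simp add: uniform_sphere_def)

lemma prob_space_uniform_sphere: "prob_space (uniform_sphere :: 'v::euclidean_space measure)"
proof -
  have "prob_space (uniform_measure lborel (ball (0::'v) 1))"
  proof (rule prob_space_uniform_measure)
    have "0 < measure lborel (ball (0::'v) 1)" by (rule content_ball_pos) simp
    thus "emeasure lborel (ball (0::'v) 1) \<noteq> 0"
      by (auto simp: measure_def)
    show "emeasure lborel (ball (0::'v) 1) \<noteq> \<infinity>" 
      using emeasure_lborel_ball_finite[of "0::'v" 1] by simp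
  qed
  thus ?thesis
    unfolding uniform_sphere_def by (rule prob_space.prob_space_distr) simp
qed

text \<open>The only exception is the origin of the ball, where \<open>sgn 0 = 0\<close>, and a
  single point is a null set.\<close>

lemma AE_uniform_sphere_norm: "AE u in (uniform_sphere :: 'v::euclidean_space measure). norm u = 1"
proof -
  have "AE x in lborel. x \<noteq> (0::'v)"
    by (rule AE_lborel_singleton)
  hence "AE x in uniform_measure lborel (ball 0 1). x \<noteq> (0::'v)"
    by (intro AE_uniform_measureI) auto
  hence "AE x in uniform_measure lborel (ball 0 1). norm (sgn x :: 'v) = 1"
    by eventually_elim (simp add: norm_sgn)
  thus ?thesis
    unfolding uniform_sphere_def by (subst AE_distr_iff) auto
qed

lemma integral_uniform_sphere_isometry:
  fixes T :: "'v::euclidean_space \<Rightarrow> 'v" and f :: "'v \<Rightarrow> real"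
  assumes T: "distr lborel borel T = lborel" "orthogonal_transformation T"
    and f: "f \<in> borel_measurable borel"
  shows "(LINT u|uniform_sphere. f (T u)) = (LINT u|uniform_sphere. f u)"
proof -
  have "linear T" using T(2) by (simp add: orthogonal_transformation)
  hence "T \<in> measurable borel borel"
    by (intro borel_measurable_continuous_onI linear_continuous_on linear_conv_bounded_linear[THEN iffD1])
  hence "(LINT u|uniform_sphere. f (T u)) = (LINT u|distr uniform_sphere borel T. f u)"
    using f by (subst integral_distr) (auto cong: measurable_cong_sets)
  thus ?thesis
    by (simp only: distr_uniform_sphere_isometry[OF T])
qed

text \<open>A continuous function is bounded on the compact sphere, which carries the whole
  measure.\<close>

lemma integrable_uniform_sphere:
  fixes f :: "'v::euclidean_space \<Rightarrow> real"
  assumes "continuous_on UNIV f"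
  shows "integrable uniform_sphere f"
proof -
  interpret prob_space "uniform_sphere :: 'v measure" by (rule prob_space_uniform_sphere)
  have "bounded (f ` sphere 0 1)"
    by (intro compact_imp_bounded compact_continuous_image continuous_on_subset[OF assms]) auto
  then obtain B where B: "\<And>u. norm u = 1 \<Longrightarrow> norm (f u) \<le> B"
    unfolding bounded_iff by fastforce
  show ?thesis
  proof (rule integrable_const_bound)
    show "AE u in uniform_sphere. norm (f u) \<le> B"
      using AE_uniform_sphere_norm by eventually_elim (rule B)
    show "f \<in> borel_measurable uniform_sphere"
      using borel_measurable_continuous_onI[OF assms] by (simp cong: measurable_cong_sets)
  qed
qed

text \<open>The antipodal map preserves the measure, so the integral equals its own
  negative.\<close>

lemma integral_uniform_sphere_odd:
  fixes f :: "'v::euclidean_space \<Rightarrow> real"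
  assumes "\<And>u. f (- u) = - f u" "f \<in> borel_measurable borel"
  shows "(LINT u|uniform_sphere. f u) = 0"
proof -
  have "distr lborel borel uminus = (lborel :: 'v measure)"
    using lborel_distr_sign_change[of "\<lambda>_::'v. -1"]
    by (simp add: sum_negf euclidean_representation)
  moreover have "orthogonal_transformation (uminus :: 'v \<Rightarrow> 'v)"
    by (simp add: orthogonal_transformation_def linear_uminus)
  ultimately have "(LINT u|uniform_sphere. f (- u)) = (LINT u|uniform_sphere. f u)"
    using assms(2) by (rule integral_uniform_sphere_isometry)
  thus ?thesis by (simp add: assms(1))
qed

text \<open>Symmetry replaces surface integrals: a sign flip kills the mixed moments, exchanging two
  coordinates equates the pure ones, and these add up to the mean of \<open>(norm u)^2\<close>,
  which is 1.\<close>

lemma uniform_sphere_second_moments: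
  fixes i j :: "'v::euclidean_space"
  assumes i: "i \<in> Basis" and j: "j \<in> Basis"
  shows "(LINT u|uniform_sphere. (u \<bullet> i) * (u \<bullet> j)) = (if i = j then 1 / real DIM('v) else 0)"
proof -
  have cont: "continuous_on UNIV (\<lambda>u::'v. (u \<bullet> a) * (u \<bullet> b))" for a b
    by (intro continuous_intros)
  note meas = borel_measurable_continuous_onI[OF cont]
  have diag: "(LINT u|uniform_sphere. (u \<bullet> b) * (u \<bullet> b)) = (LINT u|uniform_sphere. (u \<bullet> i) * (u \<bullet> i))"
    if b: "b \<in> Basis" "b \<noteq> i" for b
  proof -
    let ?T = "\<lambda>x. x - (x \<bullet> i - x \<bullet> b) *\<^sub>R (i - b)"
    have "orthogonal_transformation ?T"
      using b i by (auto simp: orthogonal_transformation_def inner_simps inner_Basis algebra_simps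
          inner_commute intro!: linearI)
    from integral_uniform_sphere_isometry[OF lborel_distr_swap_Basis[OF i b(1)] this meas[of i i]]
    show ?thesis using b i by (simp add: inner_simps inner_Basis)
  qed
  have offdiag: "(LINT u|uniform_sphere. (u \<bullet> i) * (u \<bullet> j)) = 0" if "i \<noteq> j"
  proof -
    \<comment> \<open>Only the coordinate along \<open>i\<close> is negated, so the integrand
      changes sign.\<close>
    define s where "s = (\<lambda>b. if b = i then - 1 else 1 :: real)"
    define T where "T = (\<lambda>x. \<Sum>b\<in>Basis. (s b * (x \<bullet> b)) *\<^sub>R b)"
    have T: "T x \<bullet> b = s b * (x \<bullet> b)" if "b \<in> Basis" for x b
      using that by (simp add: T_def)
    have lborel: "distr lborel borel T = lborel"
      unfolding T_def by (rule lborel_distr_sign_change) (simp add: s_def)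
    have "T v \<bullet> T w = v \<bullet> w" for v w
      unfolding euclidean_inner[of "T v" "T w"] euclidean_inner[of v w]
      by (intro sum.cong refl) (simp add: T s_def)
    moreover have "linear T"
      by (rule linearI) (auto simp: T inner_simps algebra_simps intro: euclidean_eqI)
    ultimately have "orthogonal_transformation T"
      by (simp add: orthogonal_transformation_def)
    from integral_uniform_sphere_isometry[OF lborel this meas[of i j]]
    show ?thesis using i j \<open>i \<noteq> j\<close> by (simp add: T s_def)
  qed
  have "(1 :: real) = (LINT u|(uniform_sphere :: 'v measure). 1)"
    by (simp add: prob_space.prob_space[OF prob_space_uniform_sphere, simplified])
  also have "\<dots> = (LINT u|(uniform_sphere :: 'v measure). (\<Sum>b\<in>Basis. (u \<bullet> b) * (u \<bullet> b :: real)))"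
  proof (rule integral_cong_AE)
    show "AE u in (uniform_sphere :: 'v measure). 1 = (\<Sum>b\<in>Basis. (u \<bullet> b) * (u \<bullet> b :: real))"
      using AE_uniform_sphere_norm
    proof eventually_elim
      fix u :: 'v assume "norm u = 1"
      thus "1 = (\<Sum>b\<in>Basis. (u \<bullet> b) * (u \<bullet> b :: real))"
        unfolding euclidean_inner[symmetric] by (simp add: norm_eq_1)
    qed
  qed (simp_all cong: measurable_cong_sets)
  also have "\<dots> = (\<Sum>b\<in>Basis. LINT u|(uniform_sphere :: 'v measure). (u \<bullet> b) * (u \<bullet> b))"
    by (rule Bochner_Integration.integral_sum) (rule integrable_uniform_sphere[OF cont])
  also have "\<dots> = (\<Sum>b\<in>(Basis::'v set). LINT u|uniform_sphere. (u \<bullet> i) * (u \<bullet> i))"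
    using diag by (intro sum.cong) auto
  finally show ?thesis
    using offdiag by (auto simp: field_simps)
qed

lemma integral_uniform_sphere_inner_squared:
  fixes \<alpha> :: "'v::euclidean_space"
  shows "(LINT u|uniform_sphere. (\<alpha> \<bullet> u)\<^sup>2) = (norm \<alpha>)\<^sup>2 / real DIM('v)"
proof -
  have int: "integrable uniform_sphere (\<lambda>u. (\<alpha> \<bullet> i) * (\<alpha> \<bullet> j) * ((u \<bullet> i) * (u \<bullet> j)))" for i j
    by (intro integrable_uniform_sphere continuous_intros)
  have "(\<alpha> \<bullet> u)\<^sup>2 = (\<Sum>i\<in>Basis. \<Sum>j\<in>Basis. (\<alpha> \<bullet> i) * (\<alpha> \<bullet> j) * ((u \<bullet> i) * (u \<bullet> j)))" for u
    unfolding euclidean_inner[of \<alpha> u] power2_eq_square sum_product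
    by (simp add: mult_ac)
  hence "(LINT u|uniform_sphere. (\<alpha> \<bullet> u)\<^sup>2) =
      (\<Sum>i\<in>Basis. \<Sum>j\<in>Basis. LINT u|uniform_sphere. (\<alpha> \<bullet> i) * (\<alpha> \<bullet> j) * ((u \<bullet> i) * (u \<bullet> j)))"
    using int by (simp only: Bochner_Integration.integral_sum Bochner_Integration.integrable_sum)
  also have "\<dots> = (\<Sum>i\<in>Basis. \<Sum>j\<in>Basis. (\<alpha> \<bullet> i) * (\<alpha> \<bullet> j) *
      (if i = j then 1 / real DIM('v) else 0))"
    by (intro sum.cong refl) (simp only: uniform_sphere_second_moments integral_mult_right_zero)
  also have "\<dots> = (\<Sum>i\<in>Basis. (\<alpha> \<bullet> i) * (\<alpha> \<bullet> i)) / real DIM('v)"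
    by (simp add: sum_divide_distrib if_distrib[where f = "\<lambda>z. _ * z"] cong: if_cong)
  also have "(\<Sum>i\<in>Basis. (\<alpha> \<bullet> i) * (\<alpha> \<bullet> i)) = (norm \<alpha>)\<^sup>2"
    by (simp only: euclidean_inner[symmetric] power2_norm_eq_inner)
  finally show ?thesis .
qed

section \<open>Moments of the flight\<close>

text \<open>Sigma-finite measures on a product agree once they agree on rectangles, where
  independence factorises. Independence is phrased through generated sigma-algebras because the
  flight supplies it in this form.\<close>

lemma (in prob_space) distr_pair_indep_set:
  assumes X: "random_variable S X" and Y: "random_variable T Y"
    and indep: "indep_set (sets (vimage_algebra (space M) X S)) (sets (vimage_algebra (space M) Y T))"
  shows "distr M S X \<Otimes>\<^sub>M distr M T Y = distr M (S \<Otimes>\<^sub>M T) (\<lambda>\<omega>. (X \<omega>, Y \<omega>))"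
proof -
  note XY = measurable_Pair[OF X Y]
  interpret X: prob_space "distr M S X" by (rule prob_space_distr) fact
  interpret Y: prob_space "distr M T Y" by (rule prob_space_distr) fact
  show ?thesis
  proof (rule pair_measure_eqI)
    fix A B assume "A \<in> sets (distr M S X)" "B \<in> sets (distr M T Y)"
    hence AB: "A \<in> sets S" "B \<in> sets T" by simp_all
    have "emeasure (distr M (S \<Otimes>\<^sub>M T) (\<lambda>\<omega>. (X \<omega>, Y \<omega>))) (A \<times> B) =
        prob ((X -` A \<inter> space M) \<inter> (Y -` B \<inter> space M))"
      using AB by (subst emeasure_distr[OF XY]) (auto simp: emeasure_eq_measure intro!: arg_cong[where f = prob])
    also have "\<dots> = prob (X -` A \<inter> space M) * prob (Y -` B \<inter> space M)"
      using AB by (intro arg_cong[where f = ennreal] indep_setD[OF indep] in_vimage_algebra)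
    also have "\<dots> = emeasure (distr M S X) A * emeasure (distr M T Y) B"
      using AB X Y by (simp add: emeasure_distr emeasure_eq_measure ennreal_mult)
    finally show "emeasure (distr M S X) A * emeasure (distr M T Y) B =
        emeasure (distr M (S \<Otimes>\<^sub>M T) (\<lambda>\<omega>. (X \<omega>, Y \<omega>))) (A \<times> B)" by simp
  qed (auto simp: X.sigma_finite_measure_axioms Y.sigma_finite_measure_axioms intro!: sets_pair_measure_cong)
qed

text \<open>The joint law is the product of the two laws, so by Fubini \<open>Y\<close> can be
  averaged while \<open>X\<close> is held fixed. The bound supplies integrability.\<close>

lemma (in prob_space) expectation_indep_set:
  fixes f :: "'b \<times> 'c \<Rightarrow> real"
  assumes [measurable]: "random_variable S X" "random_variable T Y"
    and indep: "indep_set (sets (vimage_algebra (space M) X S)) (sets (vimage_algebra (space M) Y T))"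
    and f[measurable]: "f \<in> borel_measurable (S \<Otimes>\<^sub>M T)"
    and bound: "\<And>z. \<bar>f z\<bar> \<le> B"
  shows "expectation (\<lambda>\<omega>. f (X \<omega>, Y \<omega>)) = expectation (\<lambda>\<omega>. expectation (\<lambda>\<omega>'. f (X \<omega>, Y \<omega>')))"
proof -
  interpret X: prob_space "distr M S X" by (rule prob_space_distr) simp
  interpret Y: prob_space "distr M T Y" by (rule prob_space_distr) simp
  interpret XY: pair_prob_space "distr M S X" "distr M T Y" ..
  have int: "integrable (distr M S X \<Otimes>\<^sub>M distr M T Y) f"
    by (rule XY.integrable_const_bound[where B = B]) (simp_all add: bound)
  have "expectation (\<lambda>\<omega>. f (X \<omega>, Y \<omega>)) = (LINT z|(distr M (S \<Otimes>\<^sub>M T) (\<lambda>\<omega>. (X \<omega>, Y \<omega>))). f z)"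
    by (subst integral_distr) simp_all
  also have "\<dots> = (LINT z|(distr M S X \<Otimes>\<^sub>M distr M T Y). f z)"
    using indep by (simp add: distr_pair_indep_set)
  also have "\<dots> = (LINT x|distr M S X. LINT y|distr M T Y. f (x, y))"
    by (rule XY.integral_fst'[symmetric]) (rule int)
  also have "\<dots> = (LINT x|distr M S X. LINT \<omega>|M. f (x, Y \<omega>))"
    by (intro Bochner_Integration.integral_cong refl integral_distr) auto
  also have "\<dots> = expectation (\<lambda>\<omega>. expectation (\<lambda>\<omega>'. f (X \<omega>, Y \<omega>')))"
    by (rule integral_distr) measurable
  finally show ?thesis .
qed

text \<open>This is Fubini on \<open>{0..t} \<times> space M\<close>, a set of finite measure, where
  a uniform bound gives integrability.\<close>

lemma (in prob_space) expectation_set_integral_swap: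
  fixes F :: "real \<Rightarrow> 'a \<Rightarrow> real"
  assumes F: "(\<lambda>(s, \<omega>). F s \<omega>) \<in> borel_measurable (lborel \<Otimes>\<^sub>M M)"
    and bound: "\<And>s \<omega>. \<bar>F s \<omega>\<bar> \<le> B"
  shows "expectation (\<lambda>\<omega>. LINT s:{0..t}|lborel. F s \<omega>) = (LINT s:{0..t}|lborel. expectation (F s))"
proof -
  have finite: "emeasure (lborel \<Otimes>\<^sub>M M) ({0..t} \<times> space M) = emeasure lborel {0..t} * emeasure M (space M)"
    by (rule emeasure_pair_measure_Times) auto
  interpret pair_sigma_finite lborel M ..
  let ?f = "\<lambda>s \<omega>. indicator {0..t} s * F s \<omega>"
  have [measurable]: "case_prod ?f \<in> borel_measurable (lborel \<Otimes>\<^sub>M M)"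
    using F by (simp add: split_beta') measurable
  have "emeasure (lborel \<Otimes>\<^sub>M M) ({0..t} \<times> space M) < \<infinity>"
    unfolding finite by (simp add: emeasure_space_1 emeasure_lborel_Icc_eq)
  hence "integrable (lborel \<Otimes>\<^sub>M M) (case_prod ?f)"
  proof (rule integrableI_bounded_set[rotated 2])
    show "AE x in lborel \<Otimes>\<^sub>M M. x \<in> {0..t} \<times> space M \<longrightarrow> norm (case_prod ?f x) \<le> B"
      by (intro AE_I2) (auto simp: bound)
    show "AE x in lborel \<Otimes>\<^sub>M M. x \<notin> {0..t} \<times> space M \<longrightarrow> case_prod ?f x = 0"
      by (intro AE_I2) (auto simp: space_pair_measure split: split_indicator_asm)
  qed auto
  from Fubini_integral[OF this] show ?thesis
    by (simp add: set_lebesgue_integral_def)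
qed

section \<open>Joint measurability and void probabilities of the Poisson process\<close>

context poisson_process
begin

text \<open>By right-continuity the value is a limit of values at slightly later grid times, of
  which there are countably many. Letting both time and sample point depend on a third variable
  yields the joint measurability that Fubini needs.\<close>

lemma measurable_N_compose:
  assumes f[measurable]: "f \<in> borel_measurable K" and h[measurable]: "h \<in> measurable K M"
  shows "(\<lambda>x. N (max 0 (f x)) (h x)) \<in> measurable K (count_space UNIV)"
proof -
  \<comment> \<open>A grid of mesh \<open>1 / Suc n\<close>. Adding 1 after the floor puts
    \<open>q n s\<close> strictly to the right of \<open>max 0 s\<close>, as a limit along
    \<open>at_right\<close> requires.\<close>
  define q where "q n s = real_of_int (\<lfloor>real (Suc n) * max 0 s\<rfloor> + 1) / real (Suc n)" for n :: nat and s :: real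
  have q_gt: "q n s > max 0 s" and q_le: "q n s \<le> max 0 s + 1 / real (Suc n)" for n s
  proof -
    let ?y = "real (Suc n) * max 0 s"
    have y: "?y < real_of_int \<lfloor>?y\<rfloor> + 1" "real_of_int \<lfloor>?y\<rfloor> + 1 \<le> ?y + 1"
      using floor_correct[of ?y] by linarith+
    show "q n s > max 0 s"
      using y(1) by (simp add: q_def less_divide_eq mult.commute)
    have "q n s \<le> (?y + 1) / real (Suc n)"
      unfolding q_def by (rule divide_right_mono) (use y(2) in auto)
    thus "q n s \<le> max 0 s + 1 / real (Suc n)"
      by (simp add: add_divide_distrib)
  qed
  have approx: "(\<lambda>x. real (N (q n (f x)) (h x))) \<in> borel_measurable K" for n
  proof -
    \<comment> \<open>The index \<open>i\<close> runs over all integers; \<open>max 0\<close> keeps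
      the time where \<open>N\<close> is known to be measurable.\<close>
    have *: "(\<lambda>x. real (N (max 0 (real_of_int (i + 1) / real (Suc n))) (h x))) \<in> borel_measurable K" for i
      using measurable_compose[OF h N_measurable[of "max 0 (real_of_int (i + 1) / real (Suc n))"]]
      by simp
    have g: "(\<lambda>x. \<lfloor>real (Suc n) * max 0 (f x)\<rfloor>) \<in> measurable K (count_space UNIV)"
      by measurable
    have "(\<lambda>x. real (N (max 0 (q n (f x))) (h x))) \<in> borel_measurable K"
      unfolding q_def by (rule measurable_compose_countable[OF * g])
    moreover have "max 0 (q n s) = q n s" for s
      using q_gt[of s n] by auto
    ultimately show ?thesis by simp
  qed
  have lim: "(\<lambda>n. real (N (q n (f x)) (h x))) \<longlonglongrightarrow> real (N (max 0 (f x)) (h x))" if "x \<in> space K" for x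
  proof -
    have "(\<lambda>n. q n (f x)) \<longlonglongrightarrow> max 0 (f x)"
    proof (rule tendsto_sandwich[where f = "\<lambda>_. max 0 (f x)"])
      show "(\<lambda>n. max 0 (f x) + 1 / real (Suc n)) \<longlonglongrightarrow> max 0 (f x)"
        using tendsto_add[OF tendsto_const[of "max 0 (f x)"] LIMSEQ_inverse_real_of_nat]
        by (simp add: inverse_eq_divide)
    qed (intro always_eventually allI less_imp_le[OF q_gt] q_le tendsto_const)+
    hence "filterlim (\<lambda>n. q n (f x)) (at_right (max 0 (f x))) sequentially"
      by (rule tendsto_imp_filterlim_at_right) (intro always_eventually allI q_gt)
    moreover have "((\<lambda>s. N s (h x)) \<longlongrightarrow> N (max 0 (f x)) (h x)) (at_right (max 0 (f x)))"
      using measurable_space[OF h that] by (intro N_right_continuous) auto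
    ultimately have "(\<lambda>n. N (q n (f x)) (h x)) \<longlonglongrightarrow> N (max 0 (f x)) (h x)"
      by (rule filterlim_compose[rotated])
    \<comment> \<open>In the discrete topology of \<open>nat\<close> a convergent sequence is
      eventually constant, so convergence passes to the reals.\<close>
    thus ?thesis
      by (intro tendsto_eventually) (auto simp: tendsto_discrete elim: eventually_mono)
  qed
  have "(\<lambda>x. real (N (max 0 (f x)) (h x))) \<in> borel_measurable K"
    by (rule borel_measurable_LIMSEQ_metric[OF approx lim])
  hence "(\<lambda>x. nat \<lfloor>real (N (max 0 (f x)) (h x))\<rfloor>) \<in> measurable K (count_space UNIV)"
    by measurable
  thus ?thesis by simp
qed

lemma prob_increment_zero:
  assumes "0 \<le> s" "s \<le> t"
  shows "prob {\<omega> \<in> space M. N t \<omega> = N s \<omega>} = exp (- rate * (t - s))"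
\<comment> \<open>The law of the increments is given only for \<open>s < t\<close>.\<close>
proof (cases "s = t")
  case True
  thus ?thesis by (simp add: prob_space)
next
  case False
  have [measurable]: "N s \<in> measurable M (count_space UNIV)" "N t \<in> measurable M (count_space UNIV)"
    using N_measurable assms by auto
  \<comment> \<open>Subtraction on \<open>nat\<close> is cut off at 0; monotonicity of the path
    excludes a spurious zero.\<close>
  have "N t \<omega> = N s \<omega> \<longleftrightarrow> N t \<omega> - N s \<omega> = 0" if "\<omega> \<in> space M" for \<omega>
    using mono_onD[OF N_mono[OF that], of s t] assms by auto
  hence "prob {\<omega> \<in> space M. N t \<omega> = N s \<omega>} = prob ((\<lambda>\<omega>. N t \<omega> - N s \<omega>) -` {0} \<inter> space M)"
    by (intro arg_cong[where f = prob]) auto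
  also have "\<dots> = measure (distr M (count_space UNIV) (\<lambda>\<omega>. N t \<omega> - N s \<omega>)) {0}"
    by (rule measure_distr[symmetric]) auto
  also have "\<dots> = exp (- rate * (t - s))"
    using assms False rate_pos by (simp add: N_increments_poisson measure_pmf_single)
  finally show ?thesis .
qed

end

section \<open>Moments of the direction in force at fixed times\<close>

context markov_random_flight
begin

lemma U_measurable [measurable]: "U k \<in> borel_measurable M"
  using U_indep by (simp add: indep_vars_def2)

lemma measurable_path:
  "(\<lambda>\<omega>. \<lambda>t\<in>{0..}. N t \<omega>) \<in> measurable M (\<Pi>\<^sub>M t\<in>{0..}. count_space UNIV)"
  by (rule measurable_restrict) (simp add: N_measurable)

lemma measurable_directions: "(\<lambda>\<omega> k. U k \<omega>) \<in> measurable M (\<Pi>\<^sub>M k\<in>UNIV. borel)"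
  by (rule measurable_PiM_single') auto

lemma measurable_direction_compose:
  assumes [measurable]: "f \<in> borel_measurable K" "h \<in> measurable K M"
  shows "(\<lambda>x. U (N (max 0 (f x)) (h x)) (h x)) \<in> borel_measurable K"
  by (rule measurable_compose_countable[OF _ measurable_N_compose]) measurable

lemma AE_norm_U: "AE \<omega> in M. \<forall>k. norm (U k \<omega>) = 1"
proof -
  have "AE \<omega> in M. norm (U k \<omega>) = 1" for k
    using AE_uniform_sphere_norm[where 'v='v] by (subst (asm) U_uniform[of k, symmetric]) (simp add: AE_distr_iff)
  thus ?thesis by (simp add: AE_all_countable)
qed

lemma expectation_U:
  fixes g :: "'v \<Rightarrow> real"
  assumes "g \<in> borel_measurable borel"
  shows "expectation (\<lambda>\<omega>. g (U k \<omega>)) = (LINT u|uniform_sphere. g u)"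
  using assms by (subst U_uniform[of k, symmetric]) (simp add: integral_distr)

text \<open>Directions with distinct indices are independent and centred, so the mean of the product
  factorises into zeros.\<close>

lemma expectation_two_directions:
  fixes g :: "'v \<Rightarrow> real"
  assumes g[measurable]: "g \<in> borel_measurable borel" and bound: "\<And>u. \<bar>g u\<bar> \<le> B"
    and centred: "(LINT u|uniform_sphere. g u) = 0"
  shows "expectation (\<lambda>\<omega>. g (U i \<omega>) * g (U j \<omega>)) =
    (if i = j then (LINT u|uniform_sphere. (g u)\<^sup>2) else 0)"
proof (cases "i = j")
  case True
  thus ?thesis
    using expectation_U[of "\<lambda>u. (g u)\<^sup>2" j] by (simp add: power2_eq_square)
next
  case False
  have "indep_vars (\<lambda>_. borel) (\<lambda>k \<omega>. g (U k \<omega>)) {i, j}"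
    by (rule indep_vars_subset[OF indep_vars_compose2[OF U_indep]]) auto
  hence "expectation (\<lambda>\<omega>. \<Prod>k\<in>{i, j}. g (U k \<omega>)) = (\<Prod>k\<in>{i, j}. expectation (\<lambda>\<omega>. g (U k \<omega>)))"
    by (rule indep_vars_lebesgue_integral[rotated])
       (auto intro!: integrable_const_bound[where B = B] simp: bound)
  thus ?thesis
    using False by (simp add: expectation_U centred)
qed

text \<open>The path of \<open>N\<close> is independent of the sequence of directions, so the random
  indices can be frozen while the directions are averaged. The function receives the whole sequence
  because the indices are random.\<close>

lemma expectation_freeze:
  fixes f :: "nat \<Rightarrow> nat \<Rightarrow> (nat \<Rightarrow> 'v) \<Rightarrow> real"
  assumes f: "\<And>i j. f i j \<in> borel_measurable (\<Pi>\<^sub>M k\<in>UNIV. borel)"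
    and bound: "\<And>i j u. \<bar>f i j u\<bar> \<le> B" and s: "s \<ge> 0" and r: "r \<ge> 0"
  shows "expectation (\<lambda>\<omega>. f (N s \<omega>) (N r \<omega>) (\<lambda>k. U k \<omega>)) =
    expectation (\<lambda>\<omega>. expectation (\<lambda>\<omega>'. f (N s \<omega>) (N r \<omega>) (\<lambda>k. U k \<omega>')))"
proof -
  let ?P = "(\<Pi>\<^sub>M t\<in>{0..}. count_space UNIV) :: (real \<Rightarrow> nat) measure"
  let ?D = "(\<Pi>\<^sub>M k\<in>UNIV. borel) :: (nat \<Rightarrow> 'v) measure"
  have [measurable]: "(\<lambda>z. fst z s) \<in> measurable (?P \<Otimes>\<^sub>M ?D) (count_space UNIV)"
    "(\<lambda>z. fst z r) \<in> measurable (?P \<Otimes>\<^sub>M ?D) (count_space UNIV)"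
    using s r by (auto intro: measurable_compose[OF measurable_fst measurable_component_singleton])
  have [measurable]: "(\<lambda>z. f i j (snd z)) \<in> borel_measurable (?P \<Otimes>\<^sub>M ?D)" for i j
    by (rule measurable_compose[OF measurable_snd f])
  \<comment> \<open>The two random indices are substituted one after the other; each has countably
    many values, so measurability survives.\<close>
  have "(\<lambda>z. f i (fst z r) (snd z)) \<in> borel_measurable (?P \<Otimes>\<^sub>M ?D)" for i
    by (rule measurable_compose_countable) measurable
  hence "(\<lambda>z. f (fst z s) (fst z r) (snd z)) \<in> borel_measurable (?P \<Otimes>\<^sub>M ?D)"
    by (rule measurable_compose_countable) measurable
  from expectation_indep_set[OF measurable_path measurable_directions N_U_indep this bound] show ?thesis
    using s r by simp
qed

lemma expectation_direction_at:
  fixes g :: "'v \<Rightarrow> real"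
  assumes g[measurable]: "g \<in> borel_measurable borel" and bound: "\<And>u. \<bar>g u\<bar> \<le> B" and "s \<ge> 0"
  shows "expectation (\<lambda>\<omega>. g (U (N s \<omega>) \<omega>)) = (LINT u|uniform_sphere. g u)"
proof -
  \<comment> \<open>A single time is at issue; \<open>r = 0\<close> merely fills the second
    slot.\<close>
  have "expectation (\<lambda>\<omega>. g (U (N s \<omega>) \<omega>)) = expectation (\<lambda>\<omega>. expectation (\<lambda>\<omega>'. g (U (N s \<omega>) \<omega>')))"
    by (rule expectation_freeze[where f = "\<lambda>i j u. g (u i)" and r = 0]) (use assms in auto)
  thus ?thesis
    by (simp add: expectation_U prob_space)
qed

text \<open>Given the path of \<open>N\<close>, the two directions coincide if no event separates
  \<open>s\<close> and \<open>r\<close>; otherwise they are independent and centred. The exponential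
  is the probability that no event lies between.\<close>

lemma expectation_directions_at:
  fixes g :: "'v \<Rightarrow> real"
  assumes g[measurable]: "g \<in> borel_measurable borel" and bound: "\<And>u. \<bar>g u\<bar> \<le> B"
    and centred: "(LINT u|uniform_sphere. g u) = 0" and s: "s \<ge> 0" and r: "r \<ge> 0"
  shows "expectation (\<lambda>\<omega>. g (U (N s \<omega>) \<omega>) * g (U (N r \<omega>) \<omega>)) =
    (LINT u|uniform_sphere. (g u)\<^sup>2) * exp (- rate * \<bar>s - r\<bar>)"
proof -
  let ?m = "LINT u|uniform_sphere. (g u)\<^sup>2"
  have [measurable]: "N s \<in> measurable M (count_space UNIV)" "N r \<in> measurable M (count_space UNIV)"
    using N_measurable s r by auto
  have "\<bar>g u * g v\<bar> \<le> B * B" for u v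
    unfolding abs_mult by (intro mult_mono bound order_trans[OF abs_ge_zero bound]) auto
  hence "expectation (\<lambda>\<omega>. g (U (N s \<omega>) \<omega>) * g (U (N r \<omega>) \<omega>)) =
      expectation (\<lambda>\<omega>. expectation (\<lambda>\<omega>'. g (U (N s \<omega>) \<omega>') * g (U (N r \<omega>) \<omega>')))"
    by (intro expectation_freeze[where f = "\<lambda>i j u. g (u i) * g (u j)"] s r) auto
  also have "\<dots> = expectation (\<lambda>\<omega>. ?m * indicator {\<omega> \<in> space M. N s \<omega> = N r \<omega>} \<omega>)"
    by (intro Bochner_Integration.integral_cong refl) (simp add: expectation_two_directions[OF g bound centred])
  also have "\<dots> = ?m * prob {\<omega> \<in> space M. N s \<omega> = N r \<omega>}"
    by (simp add: Int_absorb2)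
  also have "prob {\<omega> \<in> space M. N s \<omega> = N r \<omega>} = exp (- rate * \<bar>s - r\<bar>)"
    using prob_increment_zero[OF s, of r] prob_increment_zero[OF r, of s]
    by (cases "s \<le> r") (auto simp: eq_commute[of "N s _"])
  finally show ?thesis .
qed

end

section \<open>Integrals of the exponential correlation kernel\<close>

lemma set_integral_FTC_Icc:
  fixes F :: "real \<Rightarrow> real"
  assumes "a \<le> b" and F: "\<And>x. (F has_real_derivative f x) (at x)" and f: "\<And>x. isCont f x"
  shows "(LINT x:{a..b}|lborel. f x) = F b - F a"
  using integral_FTC_Icc_real[of a b F f] assms
  by (simp add: set_lebesgue_integral_def mult.commute)

text \<open>Splitting at \<open>r = s\<close> removes the absolute value and leaves an explicit
  antiderivative on either side.\<close>

lemma set_integral_exp_abs_diff: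
  fixes k :: real
  assumes k: "k \<noteq> 0" and s: "0 \<le> s" "s \<le> t"
  shows "(LINT r:{0..t}|lborel. exp (- k * \<bar>s - r\<bar>)) = (2 - exp (- k * s) - exp (- k * (t - s))) / k"
proof -
  have "((\<lambda>r. exp (- k * \<bar>s - r\<bar>)) has_integral (exp (- k * (s - s)) / k - exp (- k * (s - 0)) / k)) {0..s}"
  proof (rule has_integral_eq[rotated, OF fundamental_theorem_of_calculus[OF s(1)]])
    fix r
    show "((\<lambda>r. exp (- k * (s - r)) / k) has_vector_derivative exp (- k * (s - r))) (at r within {0..s})"
      unfolding has_real_derivative_iff_has_vector_derivative[symmetric]
      by (rule derivative_eq_intros refl | simp add: k)+
  qed simp
  moreover have "((\<lambda>r. exp (- k * \<bar>s - r\<bar>)) has_integral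
      (- exp (- k * (t - s)) / k - - exp (- k * (s - s)) / k)) {s..t}"
  proof (rule has_integral_eq[rotated, OF fundamental_theorem_of_calculus[OF s(2)]])
    fix r
    show "((\<lambda>r. - exp (- k * (r - s)) / k) has_vector_derivative exp (- k * (r - s))) (at r within {s..t})"
      unfolding has_real_derivative_iff_has_vector_derivative[symmetric]
      by (rule derivative_eq_intros refl | simp add: k)+
  qed simp
  ultimately have "((\<lambda>r. exp (- k * \<bar>s - r\<bar>)) has_integral
      (2 - exp (- k * s) - exp (- k * (t - s))) / k) {0..t}"
    by (rule has_integral_combine[OF s, THEN has_integral_eq_rhs]) (simp add: diff_divide_distrib)
  moreover have "set_integrable lborel {0..t} (\<lambda>r. exp (- k * \<bar>s - r\<bar>))"
    by (rule borel_integrable_atLeastAtMost') (intro continuous_intros)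
  ultimately show ?thesis
    by (simp add: set_borel_integral_eq_integral integral_unique)
qed

text \<open>Up to the second moment of one direction, this is the mean square of the time integral
  along the flight.\<close>

lemma set_integral_exp_abs_diff_twice:
  fixes k :: real
  assumes k: "k \<noteq> 0" and t: "0 \<le> t"
  shows "(LINT s:{0..t}|lborel. LINT r:{0..t}|lborel. exp (- k * \<bar>s - r\<bar>)) =
    2 * (t / k - (1 - exp (- k * t)) / k\<^sup>2)"
proof -
  have "(LINT s:{0..t}|lborel. LINT r:{0..t}|lborel. exp (- k * \<bar>s - r\<bar>)) =
      (LINT s:{0..t}|lborel. (2 - exp (- k * s) - exp (- k * (t - s))) / k)"
    by (intro set_lebesgue_integral_cong allI impI set_integral_exp_abs_diff k) auto
  also have "\<dots> = (2 * t + exp (- k * t) / k - exp (- k * (t - t)) / k) / k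
      - (2 * 0 + exp (- k * 0) / k - exp (- k * (t - 0)) / k) / k"
  proof (rule set_integral_FTC_Icc[OF t])
    fix s
    show "((\<lambda>s. (2 * s + exp (- k * s) / k - exp (- k * (t - s)) / k) / k) has_real_derivative
        (2 - exp (- k * s) - exp (- k * (t - s))) / k) (at s)"
      by (rule derivative_eq_intros refl | simp add: k)+
  qed (intro continuous_intros k)
  also have "\<dots> = 2 * (t / k - (1 - exp (- k * t)) / k\<^sup>2)"
    using k by (simp add: field_simps power2_eq_square)
  finally show ?thesis .
qed

section \<open>First three moments of a time integral along the flight\<close>

context markov_random_flight
begin

context
  fixes g :: "'v \<Rightarrow> real" and B :: real
  assumes g[measurable]: "g \<in> borel_measurable borel" and bound: "\<And>u. \<bar>g u\<bar> \<le> B"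
begin

text \<open>\<open>max 0 s\<close> because \<open>N\<close> is unspecified at negative times; only \<open>s \<ge> 0\<close> enters the integrals below.\<close>

definition observed_direction :: "real \<Rightarrow> 'a \<Rightarrow> real" where
  "observed_direction s \<omega> = g (U (N (max 0 s) \<omega>) \<omega>)"

definition observed_integral :: "real \<Rightarrow> 'a \<Rightarrow> real" where
  "observed_integral t \<omega> = (LINT s:{0..t}|lborel. observed_direction s \<omega>)"

lemma observed_direction_measurable [measurable (raw)]:
  assumes "f \<in> borel_measurable K" "h \<in> measurable K M"
  shows "(\<lambda>x. observed_direction (f x) (h x)) \<in> borel_measurable K"
  unfolding observed_direction_def by (rule measurable_compose[OF measurable_direction_compose[OF assms] g])

lemma abs_observed_direction_le: "\<bar>observed_direction s \<omega>\<bar> \<le> B"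
  by (simp add: observed_direction_def bound)

lemma observed_direction_integrable:
  assumes "\<omega> \<in> space M"
  shows "set_integrable lborel {0..t} (\<lambda>s. observed_direction s \<omega>)"
  unfolding set_integrable_def
proof (rule integrableI_bounded_set_indicator[where B = B])
  show "(\<lambda>s. observed_direction s \<omega>) \<in> borel_measurable lborel"
    using assms by measurable
qed (auto simp: abs_observed_direction_le emeasure_lborel_Icc_eq)

lemma observed_integral_measurable [measurable]: "observed_integral t \<in> borel_measurable M"
  unfolding observed_integral_def set_lebesgue_integral_def by measurable

lemma bound_nonneg: "0 \<le> B"
  using bound[of 0] by (rule order_trans[OF abs_ge_zero])

lemma abs_observed_integral_le:
  assumes "\<omega> \<in> space M" "0 \<le> t"
  shows "\<bar>observed_integral t \<omega>\<bar> \<le> B * t"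
proof -
  have "\<bar>observed_integral t \<omega>\<bar> \<le> (LINT s|lborel. indicator {0..t} s * B)"
    unfolding observed_integral_def set_lebesgue_integral_def
  proof (rule integral_abs_bound_integral)
    show "integrable lborel (\<lambda>s. indicator {0..t} s *\<^sub>R observed_direction s \<omega>)"
      using observed_direction_integrable[OF assms(1)] by (simp only: set_integrable_def)
    show "integrable lborel (\<lambda>s. indicator {0..t} s * B)"
      by (simp add: integrable_real_indicator emeasure_lborel_Icc_eq)
  qed (simp add: abs_observed_direction_le split: split_indicator)
  thus ?thesis using assms by (simp add: mult.commute)
qed

lemma expectation_observed_integral:
  assumes centred: "(LINT u|uniform_sphere. g u) = 0"
  shows "expectation (observed_integral t) = 0"
proof -
  have "expectation (observed_integral t) = (LINT s:{0..t}|lborel. expectation (observed_direction s))"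
    unfolding observed_integral_def
    by (rule expectation_set_integral_swap[OF _ abs_observed_direction_le]) measurable
  also have "\<dots> = 0"
    unfolding observed_direction_def by (simp add: expectation_direction_at[OF g bound] centred)
  finally show ?thesis .
qed

text \<open>The square is a double time integral. Two exchanges with the expectation reduce it to
  the integral of the correlation kernel over a square.\<close>

lemma expectation_observed_integral_squared:
  assumes centred: "(LINT u|uniform_sphere. g u) = 0" and t: "t \<ge> 0"
  shows "expectation (\<lambda>\<omega>. (observed_integral t \<omega>)\<^sup>2) =
    (LINT u|uniform_sphere. (g u)\<^sup>2) * (2 * (t / rate - (1 - exp (- rate * t)) / rate\<^sup>2))"
proof -
  let ?m = "LINT u|uniform_sphere. (g u)\<^sup>2"
  have two: "expectation (\<lambda>\<omega>. observed_direction s \<omega> * observed_direction r \<omega>) =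
      ?m * exp (- rate * \<bar>max 0 s - max 0 r\<bar>)" for s r
    unfolding observed_direction_def by (rule expectation_directions_at[OF g bound centred]) auto
  have one: "expectation (\<lambda>\<omega>. observed_direction s \<omega> * observed_integral t \<omega>) =
      ?m * (LINT r:{0..t}|lborel. exp (- rate * \<bar>max 0 s - r\<bar>))" for s
  proof -
    have "expectation (\<lambda>\<omega>. observed_direction s \<omega> * observed_integral t \<omega>) =
        expectation (\<lambda>\<omega>. LINT r:{0..t}|lborel. observed_direction s \<omega> * observed_direction r \<omega>)"
      by (simp add: observed_integral_def)
    also have "\<dots> = (LINT r:{0..t}|lborel. expectation (\<lambda>\<omega>. observed_direction s \<omega> * observed_direction r \<omega>))"
    proof (rule expectation_set_integral_swap[where B = "B * B"])
      show "\<bar>observed_direction s \<omega> * observed_direction r \<omega>\<bar> \<le> B * B" for r \<omega>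
        unfolding abs_mult by (intro mult_mono abs_observed_direction_le bound_nonneg abs_ge_zero)
    qed measurable
    also have "\<dots> = (LINT r:{0..t}|lborel. ?m * exp (- rate * \<bar>max 0 s - r\<bar>))"
      unfolding two by (intro set_lebesgue_integral_cong) auto
    finally show ?thesis by simp
  qed
  \<comment> \<open>The exchange asks for a bound at every point of the type, but the integral is
    known to be bounded only on \<open>space M\<close>. Clipping at \<open>B * t\<close> changes
    nothing there.\<close>
  let ?Y = "\<lambda>\<omega>. max (- (B * t)) (min (B * t) (observed_integral t \<omega>))"
  have Bt: "0 \<le> B * t"
    using bound_nonneg t by simp
  have Y: "?Y \<omega> = observed_integral t \<omega>" if "\<omega> \<in> space M" for \<omega>
    using abs_observed_integral_le[OF that t] by auto
  have "expectation (\<lambda>\<omega>. (observed_integral t \<omega>)\<^sup>2) =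
      expectation (\<lambda>\<omega>. LINT s:{0..t}|lborel. observed_direction s \<omega> * ?Y \<omega>)"
    by (intro Bochner_Integration.integral_cong refl)
       (simp add: Y power2_eq_square, simp add: observed_integral_def)
  also have "\<dots> = (LINT s:{0..t}|lborel. expectation (\<lambda>\<omega>. observed_direction s \<omega> * ?Y \<omega>))"
  proof (rule expectation_set_integral_swap[where B = "B * (B * t)"])
    show "\<bar>observed_direction s \<omega> * ?Y \<omega>\<bar> \<le> B * (B * t)" for s \<omega>
      unfolding abs_mult using Bt
      by (intro mult_mono abs_observed_direction_le bound_nonneg abs_ge_zero) auto
  qed measurable
  also have "\<dots> = (LINT s:{0..t}|lborel. expectation (\<lambda>\<omega>. observed_direction s \<omega> * observed_integral t \<omega>))"
    by (intro set_lebesgue_integral_cong allI impI Bochner_Integration.integral_cong refl) (simp_all add: Y)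
  also have "\<dots> = (LINT s:{0..t}|lborel. ?m * (LINT r:{0..t}|lborel. exp (- rate * \<bar>s - r\<bar>)))"
    unfolding one by (intro set_lebesgue_integral_cong) auto
  also have "\<dots> = ?m * (LINT s:{0..t}|lborel. LINT r:{0..t}|lborel. exp (- rate * \<bar>s - r\<bar>))"
    by simp
  finally show ?thesis
    using rate_pos t by (simp only: set_integral_exp_abs_diff_twice)
qed

text \<open>
  On \<open>N t = 0\<close> the integral is \<open>t * g (U 0)\<close>, whose cube is centred, and this event fails only with
  probability \<open>1 - exp (- rate * t)\<close>.
\<close>

lemma abs_expectation_observed_integral_cubed:
  assumes centred: "(LINT u|uniform_sphere. (g u) ^ 3) = 0" and t: "t \<ge> 0"
  shows "\<bar>expectation (\<lambda>\<omega>. (observed_integral t \<omega>) ^ 3)\<bar> \<le> 2 * (B * t) ^ 3 * (1 - exp (- rate * t))"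
proof -
  have [measurable]: "N t \<in> measurable M (count_space UNIV)"
    using N_measurable t by auto
  have g3: "expectation (\<lambda>\<omega>. (t * g (U 0 \<omega>)) ^ 3) = 0"
    using expectation_U[of "\<lambda>u. (g u) ^ 3" 0] by (simp add: power_mult_distrib centred)
  have tg: "\<bar>t * g u\<bar> \<le> B * t" for u
    using t bound[of u] by (simp add: abs_mult mult.commute[of B] mult_left_mono)
  have cube: "\<bar>x ^ 3\<bar> \<le> (B * t) ^ 3" if "\<bar>x\<bar> \<le> B * t" for x :: real
    using that by (simp add: power_abs power_mono)
  have int1: "integrable M (\<lambda>\<omega>. (t * g (U 0 \<omega>)) ^ 3)"
    by (rule integrable_const_bound[where B = "(B * t) ^ 3"]) (auto intro!: cube tg)
  have int2: "integrable M (\<lambda>\<omega>. (observed_integral t \<omega>) ^ 3)"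
    by (rule integrable_const_bound[where B = "(B * t) ^ 3"])
       (auto intro!: AE_I2 cube abs_observed_integral_le t)
  have agree: "observed_integral t \<omega> = t * g (U 0 \<omega>)" if \<omega>: "\<omega> \<in> space M" and N: "N t \<omega> = 0" for \<omega>
  proof -
    have "N (max 0 s) \<omega> = 0" if "s \<in> {0..t}" for s
      using mono_onD[OF N_mono[OF \<omega>], of "max 0 s" t] that N t by auto
    hence "observed_integral t \<omega> = (LINT s:{0..t}|lborel. g (U 0 \<omega>))"
      unfolding observed_integral_def observed_direction_def
      by (intro set_lebesgue_integral_cong) auto
    thus ?thesis using t by (simp add: set_lebesgue_integral_def)
  qed
  let ?A = "{\<omega> \<in> space M. N t \<omega> \<noteq> 0}"
  \<comment> \<open>The cube of the event-free value has mean zero, so it may be subtracted.\<close>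
  have "\<bar>expectation (\<lambda>\<omega>. (observed_integral t \<omega>) ^ 3)\<bar> =
      \<bar>expectation (\<lambda>\<omega>. (observed_integral t \<omega>) ^ 3 - (t * g (U 0 \<omega>)) ^ 3)\<bar>"
    using int1 int2 by (simp add: g3)
  also have "\<dots> \<le> expectation (\<lambda>\<omega>. \<bar>(observed_integral t \<omega>) ^ 3 - (t * g (U 0 \<omega>)) ^ 3\<bar>)"
    by (rule integral_abs_bound)
  \<comment> \<open>The difference vanishes off \<open>?A\<close>; on \<open>?A\<close> each cube is
    at most \<open>(B * t) ^ 3\<close>, whence the factor 2.\<close>
  also have "\<dots> \<le> expectation (\<lambda>\<omega>. 2 * (B * t) ^ 3 * indicator ?A \<omega>)"
  proof (rule integral_mono)
    fix \<omega> assume \<omega>: "\<omega> \<in> space M"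
    show "\<bar>(observed_integral t \<omega>) ^ 3 - (t * g (U 0 \<omega>)) ^ 3\<bar> \<le> 2 * (B * t) ^ 3 * indicator ?A \<omega>"
      using cube[OF abs_observed_integral_le[OF \<omega> t]] cube[OF tg[of "U 0 \<omega>"]] agree[OF \<omega>] \<omega>
      by (auto split: split_indicator)
  qed (use int1 int2 in \<open>auto simp: less_top[symmetric] intro!: integrable_real_indicator\<close>)
  also have "\<dots> = 2 * (B * t) ^ 3 * prob ?A"
    by (simp add: Int_absorb2)
  also have "prob ?A = 1 - prob {\<omega> \<in> space M. N t \<omega> = 0}"
    using prob_compl[of "{\<omega> \<in> space M. N t \<omega> = 0}"]
    by (simp add: set_diff_eq Collect_conj_eq[symmetric] cong: conj_cong)
  also have "prob {\<omega> \<in> space M. N t \<omega> = 0} = prob {\<omega> \<in> space M. N t \<omega> = N 0 \<omega>}"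
    by (intro arg_cong[where f = prob]) (auto simp: N_zero)
  also have "\<dots> = exp (- rate * t)"
    using prob_increment_zero[of 0 t] t by simp
  finally show ?thesis .
qed

end

end

section \<open>Taylor expansion of the characteristic function\<close>

context markov_random_flight
begin

text \<open>Directions have norm 1 only almost surely, but every path uses finitely many of them up
  to time \<open>t\<close>, so the sum of their norms is a bound. \<open>max 0 t\<close> covers
  negative \<open>t\<close>.\<close>

lemma directions_set_integrable:
  assumes \<omega>: "\<omega> \<in> space M"
  shows "set_integrable lborel {0..t} (\<lambda>s. U (N (max 0 s) \<omega>) \<omega>)"
  unfolding set_integrable_def
proof (rule integrableI_bounded_set_indicator[where B = "\<Sum>k\<le>N (max 0 t) \<omega>. norm (U k \<omega>)"])
  show "(\<lambda>s. U (N (max 0 s) \<omega>) \<omega>) \<in> borel_measurable lborel"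
    using \<omega> by (intro measurable_direction_compose) auto
  have "N (max 0 s) \<omega> \<le> N (max 0 t) \<omega>" if "s \<in> {0..t}" for s
    using that by (intro mono_onD[OF N_mono[OF \<omega>]]) auto
  thus "AE s in lborel. s \<in> {0..t} \<longrightarrow> norm (U (N (max 0 s) \<omega>) \<omega>) \<le> (\<Sum>k\<le>N (max 0 t) \<omega>. norm (U k \<omega>))"
    by (intro AE_I2 impI member_le_sum) auto
qed (auto simp: emeasure_lborel_Icc_eq)

text \<open>This passes from the gauge integral of the definition to the Lebesgue integral, for
  which measurability in the sample point and commutation with inner products are at hand.\<close>

lemma flight_position_eq_set_integral:
  assumes "\<omega> \<in> space M"
  shows "flight_position c N U t \<omega> = c *\<^sub>R (LINT s:{0..t}|lborel. U (N (max 0 s) \<omega>) \<omega>)"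
proof -
  have "flight_position c N U t \<omega> = integral {0..t} (\<lambda>s. c *\<^sub>R U (N (max 0 s) \<omega>) \<omega>)"
    unfolding flight_position_def by (intro Henstock_Kurzweil_Integration.integral_cong) auto
  thus ?thesis
    using assms by (simp add: set_borel_integral_eq_integral(2)[OF directions_set_integrable])
qed

lemma flight_position_measurable [measurable]: "flight_position c N U t \<in> borel_measurable M"
proof -
  have "(\<lambda>x. U (N (max 0 (snd x)) (fst x)) (fst x)) \<in> borel_measurable (M \<Otimes>\<^sub>M lborel)"
    by (rule measurable_direction_compose) auto
  hence "(\<lambda>\<omega>. c *\<^sub>R (LINT s:{0..t}|lborel. U (N (max 0 s) \<omega>) \<omega>)) \<in> borel_measurable M"
    unfolding set_lebesgue_integral_def by (simp add: split_beta')
  thus ?thesis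
    by (subst measurable_cong[OF flight_position_eq_set_integral])
qed

text \<open>With \<open>\<bar>X\<bar> \<le> c * norm \<alpha> * t\<close> the Taylor remainder is at
  most the fourth power over \<open>4!\<close>. The bound on the third moment carries a factor 2,
  which over \<open>3!\<close> gives \<open>1 / 3\<close>. The second moment is kept in exact
  form.\<close>

lemma char_fun_flight_expansion:
  assumes t: "t \<ge> 0"
  shows "cmod (char_fun M (flight_position c N U t) \<alpha> -
      complex_of_real (1 - (c * norm \<alpha>)\<^sup>2 / real DIM('v) * (t / rate - (1 - exp (- rate * t)) / rate\<^sup>2)))
    \<le> (c * norm \<alpha> * t) ^ 4 / 24 + (c * norm \<alpha> * t) ^ 3 * (1 - exp (- rate * t)) / 3"
proof -
  \<comment> \<open>Cutting off outside the unit ball makes \<open>g\<close> bounded everywhere, as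
    the moment lemmas require. It stays odd and equals \<open>\<alpha> \<bullet> u\<close> on the
    sphere, where almost surely all directions lie.\<close>
  define g where "g = (\<lambda>u::'v. if norm u \<le> 1 then \<alpha> \<bullet> u else 0)"
  have g[measurable]: "g \<in> borel_measurable borel"
    unfolding g_def by measurable
  have bound: "\<bar>g u\<bar> \<le> norm \<alpha>" for u
  proof -
    have "\<bar>\<alpha> \<bullet> u\<bar> \<le> norm \<alpha>" if "norm u \<le> 1"
      using Cauchy_Schwarz_ineq2[of \<alpha> u] mult_left_mono[OF that, of "norm \<alpha>"] by simp
    thus ?thesis by (simp add: g_def)
  qed
  have m1: "(LINT u|uniform_sphere. g u) = 0" and m3: "(LINT u|uniform_sphere. (g u) ^ 3) = 0"
    by (rule integral_uniform_sphere_odd; simp add: g_def)+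
  have "(LINT u|uniform_sphere. (g u)\<^sup>2) = (LINT u|uniform_sphere. (\<alpha> \<bullet> u)\<^sup>2)"
    by (rule integral_cong_AE) (use AE_uniform_sphere_norm in \<open>auto simp: g_def cong: measurable_cong_sets\<close>)
  hence m2: "(LINT u|uniform_sphere. (g u)\<^sup>2) = (norm \<alpha>)\<^sup>2 / real DIM('v)"
    by (simp add: integral_uniform_sphere_inner_squared)

  define X where "X = (\<lambda>\<omega>. c * observed_integral g t \<omega>)"
  have [measurable]: "X \<in> borel_measurable M"
    unfolding X_def using observed_integral_measurable[OF g bound] by measurable
  have X_le: "\<bar>X \<omega>\<bar> \<le> c * norm \<alpha> * t" if "\<omega> \<in> space M" for \<omega>
    using abs_observed_integral_le[OF g bound that t] speed_pos by (simp add: X_def abs_mult)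
  have X_pow_le: "\<bar>X \<omega> ^ n\<bar> \<le> (c * norm \<alpha> * t) ^ n" if "\<omega> \<in> space M" for \<omega> n
    unfolding power_abs by (intro power_mono X_le that) auto
  have int: "integrable M (\<lambda>\<omega>. X \<omega> ^ n)" for n
    by (rule integrable_const_bound[where B = "(c * norm \<alpha> * t) ^ n"]) (auto simp: X_pow_le)
  have EX: "expectation X = 0"
    using expectation_observed_integral[OF g bound m1] by (simp add: X_def)
  have EX2: "expectation (\<lambda>\<omega>. (X \<omega>)\<^sup>2) =
      2 * ((c * norm \<alpha>)\<^sup>2 / real DIM('v) * (t / rate - (1 - exp (- rate * t)) / rate\<^sup>2))"
    using expectation_observed_integral_squared[OF g bound m1 t]
    by (simp add: X_def power_mult_distrib m2)
  have "expectation (\<lambda>\<omega>. X \<omega> ^ 3) = c ^ 3 * expectation (\<lambda>\<omega>. observed_integral g t \<omega> ^ 3)"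
    by (simp add: X_def power_mult_distrib)
  hence EX3: "\<bar>expectation (\<lambda>\<omega>. X \<omega> ^ 3)\<bar> \<le> 2 * (c * norm \<alpha> * t) ^ 3 * (1 - exp (- rate * t))"
    using mult_left_mono[OF abs_expectation_observed_integral_cubed[OF g bound m3 t], of "c ^ 3"] speed_pos
    by (simp add: abs_mult power_mult_distrib mult_ac)

  have "AE \<omega> in M. \<alpha> \<bullet> flight_position c N U t \<omega> = X \<omega>"
    using AE_norm_U AE_space
  proof eventually_elim
    case (elim \<omega>)
    have "\<alpha> \<bullet> flight_position c N U t \<omega> =
        c * (\<alpha> \<bullet> (LINT s|lborel. indicator {0..t} s *\<^sub>R U (N (max 0 s) \<omega>) \<omega>))"
      by (simp add: flight_position_eq_set_integral elim set_lebesgue_integral_def)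
    also have "\<alpha> \<bullet> (LINT s|lborel. indicator {0..t} s *\<^sub>R U (N (max 0 s) \<omega>) \<omega>) =
        (LINT s|lborel. \<alpha> \<bullet> (indicator {0..t} s *\<^sub>R U (N (max 0 s) \<omega>) \<omega>))"
      by (rule integral_inner_right[symmetric])
         (use directions_set_integrable[OF elim(2)] in \<open>simp only: set_integrable_def\<close>)
    also have "\<dots> = observed_integral g t \<omega>"
      unfolding observed_integral_def[OF g bound] observed_direction_def[OF g bound] set_lebesgue_integral_def
      by (intro Bochner_Integration.integral_cong refl) (simp add: g_def elim)
    finally show ?case by (simp add: X_def)
  qed
  hence char_fun_eq: "char_fun M (flight_position c N U t) \<alpha> = (CLINT \<omega>|M. iexp (X \<omega>))"
    unfolding char_fun_def by (intro integral_cong_AE) (auto elim: eventually_mono)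
  \<comment> \<open>The cubic Taylor polynomial of \<open>iexp\<close>; its mean involves only the
    first three moments.\<close>
  define p where "p = (\<lambda>x. \<Sum>k\<le>3. (\<i> * complex_of_real x) ^ k / fact k)"
  have p_X: "p (X \<omega>) = (\<Sum>k\<le>3. \<i> ^ k / fact k * complex_of_real (X \<omega> ^ k))" for \<omega>
    by (simp add: p_def power_mult_distrib)
  have int_p: "integrable M (\<lambda>\<omega>. p (X \<omega>))"
    unfolding p_X by (intro Bochner_Integration.integrable_sum integrable_mult_right integrable_of_real int)
  have "(CLINT \<omega>|M. p (X \<omega>)) = (\<Sum>k\<le>3. CLINT \<omega>|M. \<i> ^ k / fact k * complex_of_real (X \<omega> ^ k))"
    unfolding p_X by (intro Bochner_Integration.integral_sum integrable_mult_right integrable_of_real int)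
  also have "\<dots> = (\<Sum>k\<le>3. \<i> ^ k / fact k * complex_of_real (expectation (\<lambda>\<omega>. X \<omega> ^ k)))"
    by (simp only: integral_mult_right_zero integral_complex_of_real)
  also have "\<dots> = 1 - complex_of_real (expectation (\<lambda>\<omega>. (X \<omega>)\<^sup>2)) / 2
      - \<i> * complex_of_real (expectation (\<lambda>\<omega>. X \<omega> ^ 3)) / 6"
    by (simp add: eval_nat_numeral EX prob_space del: of_real_power)
  finally have E_p: "(CLINT \<omega>|M. p (X \<omega>)) = 1 - complex_of_real (expectation (\<lambda>\<omega>. (X \<omega>)\<^sup>2)) / 2
      - \<i> * complex_of_real (expectation (\<lambda>\<omega>. X \<omega> ^ 3)) / 6" .
  have int_iexp: "integrable M (\<lambda>\<omega>. iexp (X \<omega>))"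
    by (rule integrable_const_bound[where B = 1]) auto
  have "cmod ((CLINT \<omega>|M. iexp (X \<omega>)) - (CLINT \<omega>|M. p (X \<omega>))) = cmod (CLINT \<omega>|M. iexp (X \<omega>) - p (X \<omega>))"
    by (simp add: int_iexp int_p)
  also have "\<dots> \<le> expectation (\<lambda>\<omega>. cmod (iexp (X \<omega>) - p (X \<omega>)))"
    by (rule integral_norm_bound)
  also have "\<dots> \<le> expectation (\<lambda>\<omega>. (c * norm \<alpha> * t) ^ 4 / 24)"
  proof (rule integral_mono)
    fix \<omega> assume "\<omega> \<in> space M"
    hence "\<bar>X \<omega>\<bar> ^ 4 \<le> (c * norm \<alpha> * t) ^ 4"
      using X_pow_le[of \<omega> 4] by (simp add: power_abs)
    thus "cmod (iexp (X \<omega>) - p (X \<omega>)) \<le> (c * norm \<alpha> * t) ^ 4 / 24"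
      using iexp_approx1[of "X \<omega>" 3] by (simp add: p_def fact_numeral)
  qed (intro integrable_norm Bochner_Integration.integrable_diff int_iexp int_p, simp)
  finally have remainder: "cmod ((CLINT \<omega>|M. iexp (X \<omega>)) - (CLINT \<omega>|M. p (X \<omega>))) \<le> (c * norm \<alpha> * t) ^ 4 / 24"
    by (simp add: prob_space)
  have "char_fun M (flight_position c N U t) \<alpha> -
      complex_of_real (1 - (c * norm \<alpha>)\<^sup>2 / real DIM('v) * (t / rate - (1 - exp (- rate * t)) / rate\<^sup>2)) =
      ((CLINT \<omega>|M. iexp (X \<omega>)) - (CLINT \<omega>|M. p (X \<omega>)))
      - \<i> * complex_of_real (expectation (\<lambda>\<omega>. X \<omega> ^ 3)) / 6"
    unfolding E_p EX2 char_fun_eq by simp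
  also have "cmod \<dots> \<le> cmod ((CLINT \<omega>|M. iexp (X \<omega>)) - (CLINT \<omega>|M. p (X \<omega>)))
      + \<bar>expectation (\<lambda>\<omega>. X \<omega> ^ 3)\<bar> / 6"
    by (rule order_trans[OF norm_triangle_ineq4]) (simp add: norm_mult norm_divide)
  finally show ?thesis using EX3 remainder by linarith
qed

end

section \<open>Special functions near the origin\<close>

text \<open>By the mean value theorem \<open>f x = x * f' z\<close> with \<open>0 < z < x\<close>,
  so integration raises the order by one. This carries expansions of the integrands over to
  \<open>Si\<close> and \<open>Ci\<close>.\<close>

lemma smallo_antiderivative:
  fixes f :: "real \<Rightarrow> real"
  assumes f: "\<And>x. x \<ge> 0 \<Longrightarrow> (f has_real_derivative f' x) (at x)" and "f 0 = 0"
    and f': "f' \<in> o[at_right 0](\<lambda>x. x ^ n)"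
  shows "f \<in> o[at_right 0](\<lambda>x. x ^ Suc n)"
proof (rule landau_o.smallI)
  fix e :: real assume e: "e > 0"
  from landau_o.smallD[OF f' e] obtain b where b: "b > 0"
    and le: "\<And>x. 0 < x \<Longrightarrow> x < b \<Longrightarrow> \<bar>f' x\<bar> \<le> e * x ^ n"
    by (auto simp: eventually_at_right_field power_abs)
  have "\<bar>f x\<bar> \<le> e * \<bar>x ^ Suc n\<bar>" if x: "0 < x" "x < b" for x
  proof -
    obtain z where z: "0 < z" "z < x" "f x - f 0 = (x - 0) * f' z"
      using MVT2[OF x(1), of f f'] f by auto
    have "\<bar>f x\<bar> = x * \<bar>f' z\<bar>"
      using z(3) x by (simp add: \<open>f 0 = 0\<close> abs_mult)
    also have "\<dots> \<le> x * (e * z ^ n)"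
      using z x by (intro mult_left_mono le) auto
    also have "\<dots> \<le> x * (e * x ^ n)"
      using z x e by (intro mult_left_mono power_mono) auto
    finally show ?thesis using x by (simp add: mult_ac)
  qed
  thus "eventually (\<lambda>x. norm (f x) \<le> e * norm (x ^ Suc n)) (at_right 0)"
    using b by (auto simp: eventually_at_right_field)
qed

text \<open>At 0 the quotient \<open>0 / 0\<close> is 0 by convention, which happens to be the
  limit, so the integrand of \<open>Ci\<close> is continuous as written.\<close>

lemma isCont_cosm1_over: "isCont (\<lambda>x::real. (cos x - 1) / x) x"
proof (cases "x = 0")
  case True
  have "((\<lambda>x::real. (cos x - 1) / x) \<longlongrightarrow> 0) (at 0)" by real_asymp
  thus ?thesis using True by (simp add: isCont_def)
qed (intro continuous_intros)

lemma Si_0: "Si 0 = 0"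
  by (simp add: Si_def zero_ereal_def)

lemma Ci_0: "Ci 0 = 0"
  by (simp add: Ci_def zero_ereal_def)

lemma DERIV_Ci: "(Ci has_real_derivative (cos x - 1) / x) (at x)"
proof -
  \<comment> \<open>The interval contains the base point 0 and has \<open>x\<close> in its interior,
    so the derivative within it is the full derivative.\<close>
  have "(at x within {min 0 (x - 1)..max 0 (x + 1)}) = at x"
    by (intro at_within_interior) auto
  moreover have "min 0 (x - 1) \<le> x" "x \<le> max 0 (x + 1)"
    by auto
  ultimately show ?thesis
    using interval_integral_FTC2[of "min 0 (x - 1)" 0 "max 0 (x + 1)" "\<lambda>x. (cos x - 1) / x" x]
    by (auto simp: continuous_at_imp_continuous_on isCont_cosm1_over Ci_def[abs_def] zero_ereal_def
        has_real_derivative_iff_has_vector_derivative)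
qed

text \<open>The polynomial is the antiderivative of \<open>1 - y^2 / 6\<close>, the beginning of the
  series of \<open>sinc\<close>.\<close>

lemma Si_smallo: "(\<lambda>y. Si y - (y - y ^ 3 / 18)) \<in> o[at_right 0](\<lambda>y. y ^ 4)"
proof -
  have "(\<lambda>y::real. sin y / y - (1 - y\<^sup>2 / 6)) \<in> o[at_right 0](\<lambda>y. y ^ 3)" by real_asymp
  \<comment> \<open>At 0 the quotient \<open>sin y / y\<close> is 0 by convention while
    \<open>sinc 0 = 1\<close>; the derivative of \<open>Si\<close> there is the latter.\<close>
  moreover have "eventually (\<lambda>y. sin y / y - (1 - y\<^sup>2 / 6) = sinc y - (1 - y\<^sup>2 / 6)) (at_right 0)"
    by (rule eventually_mono[OF eventually_at_right_less]) simp
  note landau_o.small.in_cong[OF this]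
  ultimately have "(\<lambda>y. sinc y - (1 - y\<^sup>2 / 6)) \<in> o[at_right 0](\<lambda>y. y ^ 3)" by simp
  moreover have "((\<lambda>y. Si y - (y - y ^ 3 / 18)) has_real_derivative sinc x - (1 - x\<^sup>2 / 6)) (at x)" for x
    by (rule derivative_eq_intros DERIV_Si refl | simp)+
  ultimately show ?thesis
    using smallo_antiderivative[of "\<lambda>y. Si y - (y - y ^ 3 / 18)" "\<lambda>x. sinc x - (1 - x\<^sup>2 / 6)" 3]
    by (simp add: Si_0)
qed

lemma Ci_smallo: "(\<lambda>y. Ci y - (- y\<^sup>2 / 4 + y ^ 4 / 96)) \<in> o[at_right 0](\<lambda>y. y ^ 4)"
proof -
  have "(\<lambda>y::real. (cos y - 1) / y - (- y / 2 + y ^ 3 / 24)) \<in> o[at_right 0](\<lambda>y. y ^ 3)"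
    by real_asymp
  moreover have "((\<lambda>y. Ci y - (- y\<^sup>2 / 4 + y ^ 4 / 96)) has_real_derivative
      (cos x - 1) / x - (- x / 2 + x ^ 3 / 24)) (at x)" for x
    by (rule derivative_eq_intros DERIV_Ci refl | simp)+
  ultimately show ?thesis
    using smallo_antiderivative[of "\<lambda>y. Ci y - (- y\<^sup>2 / 4 + y ^ 4 / 96)"
        "\<lambda>y. (cos y - 1) / y - (- y / 2 + y ^ 3 / 24)" 3]
    by (simp add: Ci_0)
qed

text \<open>Division by \<open>x^2\<close> costs two orders, so the numerator is expanded to order
  4: the sine part gives \<open>2 * x^2 - 7 / 9 * x^4\<close>, the cosine part
  \<open>- x^2 + 2 / 3 * x^4\<close>.\<close>

lemma Si_Ci_smallo:
  "(\<lambda>x. (sin x * Si (2 * x) + cos x * Ci (2 * x)) / x\<^sup>2 - (1 - x\<^sup>2 / 9)) \<in> o[at_right 0](\<lambda>x. x\<^sup>2)"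
proof -
  have lim: "filterlim (\<lambda>x::real. 2 * x) (at_right 0) (at_right 0)" by real_asymp
  have four: "(\<lambda>x. (2 * x) ^ 4) \<in> O[at_right 0](\<lambda>x::real. x ^ 4)" by real_asymp
  have S: "(\<lambda>x. sin x * (Si (2 * x) - (2 * x - (2 * x) ^ 3 / 18))) \<in> o[at_right 0](\<lambda>x. x ^ 4)"
  proof -
    have "sin \<in> O[at_right 0](\<lambda>_. 1 :: real)" by real_asymp
    moreover have "(\<lambda>x. Si (2 * x) - (2 * x - (2 * x) ^ 3 / 18)) \<in> o[at_right 0](\<lambda>x. x ^ 4)"
      using landau_o.small_big_trans[OF landau_o.small.compose[OF Si_smallo lim] four] .
    ultimately show ?thesis
      using landau_o.big_small_mult[of sin _ "\<lambda>_. 1"] by simp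
  qed
  have C: "(\<lambda>x. cos x * (Ci (2 * x) - (- (2 * x)\<^sup>2 / 4 + (2 * x) ^ 4 / 96))) \<in> o[at_right 0](\<lambda>x. x ^ 4)"
  proof -
    have "cos \<in> O[at_right 0](\<lambda>_. 1 :: real)" by real_asymp
    moreover have "(\<lambda>x. Ci (2 * x) - (- (2 * x)\<^sup>2 / 4 + (2 * x) ^ 4 / 96)) \<in> o[at_right 0](\<lambda>x. x ^ 4)"
      using landau_o.small_big_trans[OF landau_o.small.compose[OF Ci_smallo lim] four] .
    ultimately show ?thesis
      using landau_o.big_small_mult[of cos _ "\<lambda>_. 1"] by simp
  qed
  \<comment> \<open>Once \<open>Si\<close> and \<open>Ci\<close> are replaced by polynomials only
    elementary functions remain; \<open>S\<close>, \<open>C\<close> and \<open>R\<close> add up to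
    the error of the numerator.\<close>
  have R: "(\<lambda>x::real. sin x * (2 * x - (2 * x) ^ 3 / 18) + cos x * (- (2 * x)\<^sup>2 / 4 + (2 * x) ^ 4 / 96)
      - (x\<^sup>2 - x ^ 4 / 9)) \<in> o[at_right 0](\<lambda>x. x ^ 4)"
    by real_asymp
  have "(\<lambda>x. inverse (x\<^sup>2) * (sin x * Si (2 * x) + cos x * Ci (2 * x) - (x\<^sup>2 - x ^ 4 / 9)))
      \<in> o[at_right 0](\<lambda>x. inverse (x\<^sup>2) * x ^ 4)"
    using sum_in_smallo(1)[OF sum_in_smallo(1)[OF S C] R]
    by (intro landau_o.small.mult_left) (simp add: algebra_simps)
  moreover have "(\<lambda>x. inverse (x\<^sup>2) * x ^ 4) \<in> O[at_right 0](\<lambda>x::real. x\<^sup>2)"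
    by real_asymp
  ultimately have "(\<lambda>x. inverse (x\<^sup>2) * (sin x * Si (2 * x) + cos x * Ci (2 * x) - (x\<^sup>2 - x ^ 4 / 9)))
      \<in> o[at_right 0](\<lambda>x. x\<^sup>2)"
    by (rule landau_o.small_big_trans)
  moreover have "eventually (\<lambda>x::real. (sin x * Si (2 * x) + cos x * Ci (2 * x)) / x\<^sup>2 - (1 - x\<^sup>2 / 9) =
      inverse (x\<^sup>2) * (sin x * Si (2 * x) + cos x * Ci (2 * x) - (x\<^sup>2 - x ^ 4 / 9))) (at_right 0)"
  proof (rule eventually_mono[OF eventually_at_right_less])
    fix x :: real assume "0 < x"
    hence *: "inverse (x\<^sup>2) * (x\<^sup>2 - x ^ 4 / 9) = 1 - x\<^sup>2 / 9"
      by (simp add: field_simps power2_eq_square power4_eq_xxxx)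
    have "inverse (x\<^sup>2) * (w - r) = w / x\<^sup>2 - inverse (x\<^sup>2) * r" for w r
      by (simp add: divide_inverse right_diff_distrib)
    from this[of _ "x\<^sup>2 - x ^ 4 / 9"] show "(sin x * Si (2 * x) + cos x * Ci (2 * x)) / x\<^sup>2 - (1 - x\<^sup>2 / 9) =
        inverse (x\<^sup>2) * (sin x * Si (2 * x) + cos x * Ci (2 * x) - (x\<^sup>2 - x ^ 4 / 9))"
      by (simp only: *)
  qed
  note landau_o.small.in_cong[OF this]
  ultimately show ?thesis by simp
qed

section \<open>Bessel functions near the origin\<close>

text \<open>In \<open>rGamma z = z * rGamma (z + 1)\<close> the factor
  \<open>z = \<nu> + k + 1\<close> is at least 1. The bound makes the Bessel series comparable with
  the exponential series.\<close>

lemma abs_rGamma_add_nat_le: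
  fixes \<nu> :: real
  assumes "\<nu> \<ge> 0"
  shows "\<bar>rGamma (\<nu> + real k + 1)\<bar> \<le> \<bar>rGamma (\<nu> + 1)\<bar>"
proof (induction k)
  case (Suc k)
  have "\<bar>rGamma (\<nu> + real (Suc k) + 1)\<bar> \<le> (\<nu> + real k + 1) * \<bar>rGamma (\<nu> + real (Suc k) + 1)\<bar>"
    using mult_right_mono[of 1 "\<nu> + real k + 1" "\<bar>rGamma (\<nu> + real (Suc k) + 1)\<bar>"] assms by simp
  also have "\<dots> = \<bar>rGamma (\<nu> + real k + 1)\<bar>"
    using assms by (subst rGamma_plus1[of "\<nu> + real k + 1", symmetric]) (simp add: abs_mult add_ac)
  finally show ?case using Suc.IH by simp
qed simp

text \<open>Divided by \<open>(x / 2) powr \<nu>\<close>, the Bessel series is an everywhere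
  convergent power series \<open>G\<close> in \<open>(x / 2)^2\<close>. Differentiability of
  \<open>G\<close> at 0 controls its distance from the constant term.\<close>

lemma bessel_J_bigo:
  assumes \<nu>: "\<nu> \<ge> 0"
  shows "(\<lambda>x. bessel_J \<nu> x / (x / 2) powr \<nu> - rGamma (\<nu> + 1)) \<in> O[at_right 0](\<lambda>x. x\<^sup>2)"
proof -
  define a where "a k = (- 1) ^ k * rGamma (\<nu> + real k + 1) / fact k" for k
  define G where "G y = (\<Sum>k. a k * y ^ k)" for y
  have summable: "summable (\<lambda>k. a k * y ^ k)" for y
  proof (rule summable_comparison_test')
    show "summable (\<lambda>k. \<bar>rGamma (\<nu> + 1)\<bar> * (\<bar>y\<bar> ^ k / fact k))"
      using summable_exp[of "\<bar>y\<bar>"] by (intro summable_mult) (simp add: field_simps)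
    fix k
    show "norm (a k * y ^ k) \<le> \<bar>rGamma (\<nu> + 1)\<bar> * (\<bar>y\<bar> ^ k / fact k)"
      using mult_right_mono[OF abs_rGamma_add_nat_le[OF \<nu>, of k], of "\<bar>y\<bar> ^ k / fact k"]
      by (simp add: a_def abs_mult power_abs)
  qed
  have "(G has_real_derivative (\<Sum>k. diffs a k * 0 ^ k)) (at 0)"
    unfolding G_def by (rule termdiffs_strong_converges_everywhere) (rule summable)
  hence "((\<lambda>y. (G y - G 0) / y) \<longlongrightarrow> (\<Sum>k. diffs a k * 0 ^ k)) (at 0)"
    by (simp add: has_field_derivative_iff)
  hence "(\<lambda>y. G y - G 0) \<in> O[at 0](\<lambda>y. y)"
    by (rule bigoI_tendsto) (simp add: eventually_at_filter)
  moreover have "filterlim (\<lambda>x::real. (x / 2)\<^sup>2) (at 0) (at_right 0)" by real_asymp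
  ultimately have "(\<lambda>x. G ((x / 2)\<^sup>2) - G 0) \<in> O[at_right 0](\<lambda>x. (x / 2)\<^sup>2)"
    by (rule landau_o.big.compose)
  moreover have "(\<lambda>x. (x / 2)\<^sup>2) \<in> O[at_right 0](\<lambda>x::real. x\<^sup>2)" by real_asymp
  ultimately have G: "(\<lambda>x. G ((x / 2)\<^sup>2) - G 0) \<in> O[at_right 0](\<lambda>x. x\<^sup>2)"
    by (rule landau_o.big_trans)
  have G0: "G 0 = rGamma (\<nu> + 1)"
    unfolding G_def by (subst powser_zero) (simp add: a_def)
  have "bessel_J \<nu> x / (x / 2) powr \<nu> = G ((x / 2)\<^sup>2)" if x: "x > 0" for x
  proof -
    have "bessel_J \<nu> x = (\<Sum>k. (x / 2) powr \<nu> * (a k * ((x / 2)\<^sup>2) ^ k))"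
      unfolding bessel_J_def
    proof (rule suminf_cong)
      fix k
      have "(x / 2) powr (2 * real k + \<nu>) = (x / 2) powr \<nu> * ((x / 2)\<^sup>2) ^ k"
        using x powr_realpow[of "x / 2" "2 * k"] by (simp add: powr_add power_mult)
      thus "(- 1) ^ k * rGamma (\<nu> + real k + 1) / fact k * (x / 2) powr (2 * real k + \<nu>) =
          (x / 2) powr \<nu> * (a k * ((x / 2)\<^sup>2) ^ k)"
        by (simp add: a_def)
    qed
    also have "\<dots> = (x / 2) powr \<nu> * G ((x / 2)\<^sup>2)"
      unfolding G_def by (rule suminf_mult[OF summable])
    finally show ?thesis using x by simp
  qed
  hence "eventually (\<lambda>x. bessel_J \<nu> x / (x / 2) powr \<nu> - rGamma (\<nu> + 1) = G ((x / 2)\<^sup>2) - G 0) (at_right 0)"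
    unfolding G0 by (intro eventually_mono[OF eventually_at_right_less]) simp
  from landau_o.big.in_cong[OF this] G show ?thesis by simp
qed

lemma rGamma_5_2: "rGamma (5 / 2 :: real) = 4 / (3 * sqrt pi)"
proof -
  have "rGamma (1 / 2 :: real) = 1 / sqrt pi"
    by (simp add: rGamma_inverse_Gamma Gamma_one_half_real inverse_eq_divide)
  thus ?thesis
    using rGamma_plus1[of "1 / 2 :: real"] rGamma_plus1[of "3 / 2 :: real"] by simp
qed

lemma bessel_J_1_smallo: "(\<lambda>x. bessel_J 1 x / x - 1 / 2) \<in> o[at_right 0](\<lambda>x. x)"
proof -
  have "(\<lambda>x. 1 / 2 * (bessel_J 1 x / (x / 2) powr 1 - rGamma (1 + 1))) \<in> O[at_right 0](\<lambda>x. x\<^sup>2)"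
    using bessel_J_bigo[of 1] by simp
  moreover have "(\<lambda>x::real. x\<^sup>2) \<in> o[at_right 0](\<lambda>x. x)" by real_asymp
  ultimately have "(\<lambda>x. 1 / 2 * (bessel_J 1 x / (x / 2) powr 1 - rGamma (1 + 1))) \<in> o[at_right 0](\<lambda>x. x)"
    by (rule landau_o.big_small_trans)
  moreover have "rGamma (1 + 1 :: real) = 1"
    using rGamma_plus1[of "1 :: real"] by simp
  hence "eventually (\<lambda>x. bessel_J 1 x / x - 1 / 2 =
      1 / 2 * (bessel_J 1 x / (x / 2) powr 1 - rGamma (1 + 1))) (at_right 0)"
    by (intro eventually_mono[OF eventually_at_right_less]) (simp add: field_simps)
  note landau_o.small.in_cong[OF this]
  ultimately show ?thesis by simp
qed

text \<open>As \<open>(2 * x) powr (3 / 2) = 8 * (x / 2) powr (3 / 2)\<close>, the limit is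
  \<open>sqrt pi / 8 * rGamma (5 / 2) = 1 / 6\<close>.\<close>

lemma bessel_J_3_2_smallo:
  "(\<lambda>x. sqrt pi * bessel_J (3 / 2) x / (2 * x) powr (3 / 2) - 1 / 6) \<in> o[at_right 0](\<lambda>_. 1)"
proof -
  have "(\<lambda>x. sqrt pi / 8 * (bessel_J (3 / 2) x / (x / 2) powr (3 / 2) - rGamma (3 / 2 + 1))) \<in> O[at_right 0](\<lambda>x. x\<^sup>2)"
    using bessel_J_bigo[of "3 / 2"] by simp
  moreover have "(\<lambda>x::real. x\<^sup>2) \<in> o[at_right 0](\<lambda>_. 1)" by real_asymp
  ultimately have "(\<lambda>x. sqrt pi / 8 * (bessel_J (3 / 2) x / (x / 2) powr (3 / 2) - rGamma (3 / 2 + 1)))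
      \<in> o[at_right 0](\<lambda>_. 1)"
    by (rule landau_o.big_small_trans)
  moreover have "sqrt pi * bessel_J (3 / 2) x / (2 * x) powr (3 / 2) - 1 / 6 =
      sqrt pi / 8 * (bessel_J (3 / 2) x / (x / 2) powr (3 / 2) - rGamma (3 / 2 + 1))" if "x > 0" for x
  proof -
    have "(2 * x) powr (3 / 2) = 4 powr (3 / 2) * (x / 2) powr (3 / 2)"
      using powr_mult[of 4 "x / 2" "3 / 2"] that by simp
    also have "4 powr (3 / 2) = (8 :: real)"
      using powr_powr[of 2 2 "3 / 2 :: real"] by (simp add: powr_numeral)
    finally show ?thesis
      using that by (simp add: rGamma_5_2 right_diff_distrib)
  qed
  hence "eventually (\<lambda>x. sqrt pi * bessel_J (3 / 2) x / (2 * x) powr (3 / 2) - 1 / 6 =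
      sqrt pi / 8 * (bessel_J (3 / 2) x / (x / 2) powr (3 / 2) - rGamma (3 / 2 + 1))) (at_right 0)"
    by (intro eventually_mono[OF eventually_at_right_less])
  note landau_o.small.in_cong[OF this]
  ultimately show ?thesis by simp
qed

section \<open>The asymptotic formula\<close>

text \<open>When \<open>\<beta>\<close> tends to 0, \<open>k * norm \<beta>\<close> tends to 0 from
  the right. Extending a radial function by continuity therefore means resetting its profile at 0 to
  the right limit.\<close>

lemma extend_to_0_radial:
  fixes P :: "real \<Rightarrow> real" and \<alpha> :: "'v::euclidean_space"
  assumes "(P \<longlongrightarrow> p) (at_right 0)" and k: "k > 0"
  shows "extend_to_0 (\<lambda>\<beta>::'v. a * P (k * norm \<beta>)) \<alpha> = a * (P(0 := p)) (k * norm \<alpha>)"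
proof -
  have "((\<lambda>\<beta>::'v. k * norm \<beta>) \<longlongrightarrow> k * norm (0::'v)) (at 0)"
    by (intro tendsto_intros)
  moreover have "eventually (\<lambda>\<beta>::'v. k * norm \<beta> > 0) (at 0)"
    using k by (simp add: eventually_at_filter)
  ultimately have "filterlim (\<lambda>\<beta>::'v. k * norm \<beta>) (at_right 0) (at 0)"
    by (intro tendsto_imp_filterlim_at_right) simp_all
  hence "((\<lambda>\<beta>::'v. a * P (k * norm \<beta>)) \<longlongrightarrow> a * p) (at 0)"
    by (intro tendsto_mult_left filterlim_compose[OF assms(1)])
  hence "Lim (at 0) (\<lambda>\<beta>::'v. a * P (k * norm \<beta>)) = a * p"
    by (intro tendsto_Lim) simp_all
  thus ?thesis using k by (simp add: extend_to_0_def)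
qed

text \<open>Substitute \<open>x = \<kappa> * t\<close>. For \<open>\<kappa> = 0\<close> the reset
  value \<open>p = q 0\<close> makes the difference vanish identically, so
  \<open>\<alpha> = 0\<close> is treated along with all other cases.\<close>

lemma smallo_upd_0_compose:
  fixes P q :: "real \<Rightarrow> real"
  assumes P: "(\<lambda>x. P x - q x) \<in> o[at_right 0](\<lambda>x. x ^ n)" and q: "q 0 = p" and \<kappa>: "\<kappa> \<ge> 0"
  shows "(\<lambda>t. (P(0 := p)) (\<kappa> * t) - q (\<kappa> * t)) \<in> o[at_right 0](\<lambda>t. t ^ n)"
proof (cases "\<kappa> = 0")
  case False
  with \<kappa> have "\<kappa> > 0" by simp
  hence "filterlim (\<lambda>t. \<kappa> * t) (at_right 0) (at_right 0)"
    by real_asymp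
  hence "(\<lambda>t. P (\<kappa> * t) - q (\<kappa> * t)) \<in> o[at_right 0](\<lambda>t. (\<kappa> * t) ^ n)"
    by (rule landau_o.small.compose[OF P])
  moreover have "(\<lambda>t. (\<kappa> * t) ^ n) \<in> O[at_right 0](\<lambda>t. t ^ n)"
    by (simp add: power_mult_distrib)
  ultimately have "(\<lambda>t. P (\<kappa> * t) - q (\<kappa> * t)) \<in> o[at_right 0](\<lambda>t. t ^ n)"
    by (rule landau_o.small_big_trans)
  moreover have "eventually (\<lambda>t. (P(0 := p)) (\<kappa> * t) - q (\<kappa> * t) = P (\<kappa> * t) - q (\<kappa> * t)) (at_right 0)"
    using False by (intro eventually_mono[OF eventually_at_right_less]) auto
  note landau_o.small.in_cong[OF this]
  ultimately show ?thesis by simp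
qed (simp add: q)

lemma smallo_complex_of_real_bound:
  assumes "eventually (\<lambda>x. cmod (f x) \<le> g x) F" "g \<in> o[F](h)"
  shows "f \<in> o[F](\<lambda>x. complex_of_real (h x))"
proof (rule landau_o.smallI)
  fix e :: real assume "e > 0"
  with assms(2) have "eventually (\<lambda>x. norm (g x) \<le> e * norm (h x)) F"
    by (rule landau_o.smallD)
  with assms(1) show "eventually (\<lambda>x. cmod (f x) \<le> e * cmod (complex_of_real (h x))) F"
    by eventually_elim (simp only: norm_of_real real_norm_def)
qed

lemma tendsto_of_smallo_diff:
  fixes P q :: "real \<Rightarrow> real"
  assumes P: "(\<lambda>x. P x - q x) \<in> o[at_right 0](\<lambda>x. x ^ n)" and q: "(q \<longlongrightarrow> p) (at_right 0)"
  shows "(P \<longlongrightarrow> p) (at_right 0)"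
proof -
  have "(\<lambda>x. x ^ n) \<in> O[at_right 0](\<lambda>_. 1 :: real)"
    by (cases n) real_asymp+
  with P have "(\<lambda>x. P x - q x) \<in> o[at_right 0](\<lambda>_. 1)"
    by (rule landau_o.small_big_trans)
  hence "((\<lambda>x. P x - q x) \<longlongrightarrow> 0) (at_right 0)"
    by (auto dest: smalloD_tendsto)
  from tendsto_add[OF this q] show ?thesis by simp
qed

text \<open>With \<open>s = lam * t\<close> the terms free of \<open>\<kappa>\<close> and those carrying \<open>\<kappa>\<^sup>2\<close> cancel separately up to order 3.\<close>

lemma expansion_coefficients:
  fixes \<kappa> lam :: real
  assumes lam: "lam > 0"
  shows "(\<lambda>t. exp (- lam * t) * (1 - (\<kappa> * t)\<^sup>2 / 6 + lam * t * (1 - (\<kappa> * t)\<^sup>2 / 9)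
        + lam\<^sup>2 * t\<^sup>2 * (1 / 2) + lam ^ 3 * t ^ 3 * (1 / 6))
      - (1 - \<kappa>\<^sup>2 / 3 * (t / lam - (1 - exp (- lam * t)) / lam\<^sup>2))) \<in> o[at_right 0](\<lambda>t. t ^ 3)"
proof -
  \<comment> \<open>Here \<open>s = lam * t\<close>. The function \<open>f\<close> is
    \<open>exp (- s)\<close> times the cubic Taylor polynomial of \<open>exp s\<close>, minus 1. The
    function \<open>g\<close> compares the exact second moment with \<open>s^2 / 6\<close> from the
    sine quotient and \<open>s^3 / 9\<close> from the \<open>Si\<close> and \<open>Ci\<close>
    term.\<close>
  define f where "f = (\<lambda>s::real. exp (- s) * (1 + s + s\<^sup>2 / 2 + s ^ 3 / 6) - 1)"
  define g where "g = (\<lambda>s::real. (s - 1 + exp (- s)) / 3 - exp (- s) * (s\<^sup>2 / 6 + s ^ 3 / 9))"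
  have "f \<in> o[at_right 0](\<lambda>s. s ^ 3)" "g \<in> o[at_right 0](\<lambda>s. s ^ 3)"
    unfolding f_def g_def by real_asymp+
  hence "(\<lambda>s. f s + (\<kappa> / lam)\<^sup>2 * g s) \<in> o[at_right 0](\<lambda>s. s ^ 3)"
    by (intro sum_in_smallo landau_o.small.cmult_in_iff'[THEN iffD2]) auto
  moreover have "filterlim (\<lambda>t. lam * t) (at_right 0) (at_right 0)"
    using lam by real_asymp
  ultimately have "(\<lambda>t. f (lam * t) + (\<kappa> / lam)\<^sup>2 * g (lam * t)) \<in> o[at_right 0](\<lambda>t. (lam * t) ^ 3)"
    by (rule landau_o.small.compose)
  moreover have "(\<lambda>t. (lam * t) ^ 3) \<in> O[at_right 0](\<lambda>t. t ^ 3)"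
    by (simp add: power_mult_distrib)
  ultimately have "(\<lambda>t. f (lam * t) + (\<kappa> / lam)\<^sup>2 * g (lam * t)) \<in> o[at_right 0](\<lambda>t. t ^ 3)"
    by (rule landau_o.small_big_trans)
  moreover have "f (lam * t) + (\<kappa> / lam)\<^sup>2 * g (lam * t) =
      exp (- lam * t) * (1 - (\<kappa> * t)\<^sup>2 / 6 + lam * t * (1 - (\<kappa> * t)\<^sup>2 / 9)
        + lam\<^sup>2 * t\<^sup>2 * (1 / 2) + lam ^ 3 * t ^ 3 * (1 / 6))
      - (1 - \<kappa>\<^sup>2 / 3 * (t / lam - (1 - exp (- lam * t)) / lam\<^sup>2))" for t
    using lam by (simp add: f_def g_def field_simps power2_eq_square power3_eq_cube)
  ultimately show ?thesis by simp
qed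

theorem theorem2:
  fixes M :: "'a measure" and lam c :: real
    and N :: "real \<Rightarrow> 'a \<Rightarrow> nat" and U :: "nat \<Rightarrow> 'a \<Rightarrow> real ^ 3"
    and \<alpha> :: "real ^ 3"
  assumes "markov_random_flight M lam N c U"
  shows "(\<lambda>t. char_fun M (flight_position c N U t) \<alpha> -
           complex_of_real (exp (- lam * t) *
             (extend_to_0 (\<lambda>\<beta>. sin (c * t * norm \<beta>) / (c * t * norm \<beta>)) \<alpha>
            + extend_to_0 (\<lambda>\<beta>. lam / (c\<^sup>2 * t * (norm \<beta>)\<^sup>2) *
                (sin (c * t * norm \<beta>) * Si (2 * c * t * norm \<beta>)
               + cos (c * t * norm \<beta>) * Ci (2 * c * t * norm \<beta>))) \<alpha>
            + extend_to_0 (\<lambda>\<beta>. lam\<^sup>2 * t / (c * norm \<beta>) * bessel_J 1 (c * t * norm \<beta>)) \<alpha>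
            + extend_to_0 (\<lambda>\<beta>. lam ^ 3 * sqrt pi * t powr (3 / 2) / (2 * c * norm \<beta>) powr (3 / 2)
                * bessel_J (3 / 2) (c * t * norm \<beta>)) \<alpha>)))
         \<in> o[at_right 0](\<lambda>t. complex_of_real (t ^ 3))"
proof -
  interpret markov_random_flight M lam N c U by fact
  define \<kappa> where "\<kappa> = c * norm \<alpha>"
  have \<kappa>: "\<kappa> \<ge> 0" using speed_pos by (simp add: \<kappa>_def)
  \<comment> \<open>The main part of the characteristic function in dimension 3, to which the
    formula is compared.\<close>
  define h where "h = (\<lambda>t. 1 - \<kappa>\<^sup>2 / 3 * (t / lam - (1 - exp (- lam * t)) / lam\<^sup>2))"

  \<comment> \<open>Profiles in \<open>x = c * t * norm \<beta>\<close>, left after splitting off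
    \<open>1\<close>, \<open>lam * t\<close>, \<open>lam^2 * t^2\<close> and
    \<open>lam^3 * t^3\<close>. These prefactors make errors of order \<open>o(x^3)\<close>,
    \<open>o(x^2)\<close>, \<open>o(x)\<close> and \<open>o(1)\<close> sufficient.\<close>
  define P1 where "P1 = (\<lambda>x::real. sin x / x)"
  define P2 where "P2 = (\<lambda>x. (sin x * Si (2 * x) + cos x * Ci (2 * x)) / x\<^sup>2)"
  define P3 where "P3 = (\<lambda>x. bessel_J 1 x / x)"
  define P4 where "P4 = (\<lambda>x. sqrt pi * bessel_J (3 / 2) x / (2 * x) powr (3 / 2))"
  have P1: "(\<lambda>x. P1 x - (1 - x\<^sup>2 / 6)) \<in> o[at_right 0](\<lambda>x. x ^ 3)"
    unfolding P1_def by real_asymp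
  have P2: "(\<lambda>x. P2 x - (1 - x\<^sup>2 / 9)) \<in> o[at_right 0](\<lambda>x. x ^ 2)"
    unfolding P2_def by (rule Si_Ci_smallo)
  have P3: "(\<lambda>x. P3 x - 1 / 2) \<in> o[at_right 0](\<lambda>x. x ^ 1)"
    unfolding P3_def using bessel_J_1_smallo by simp
  have P4: "(\<lambda>x. P4 x - 1 / 6) \<in> o[at_right 0](\<lambda>x. x ^ 0)"
    unfolding P4_def using bessel_J_3_2_smallo by simp
  have lim1: "(P1 \<longlongrightarrow> 1) (at_right 0)"
    by (rule tendsto_of_smallo_diff[OF P1]) real_asymp
  have lim2: "(P2 \<longlongrightarrow> 1) (at_right 0)"
    by (rule tendsto_of_smallo_diff[OF P2]) real_asymp
  have lim3: "(P3 \<longlongrightarrow> 1 / 2) (at_right 0)"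
    by (rule tendsto_of_smallo_diff[OF P3]) simp
  have lim4: "(P4 \<longlongrightarrow> 1 / 6) (at_right 0)"
    by (rule tendsto_of_smallo_diff[OF P4]) simp

  define Q1 where "Q1 t = (P1(0 := 1)) (\<kappa> * t)" for t
  define Q2 where "Q2 t = (P2(0 := 1)) (\<kappa> * t)" for t
  define Q3 where "Q3 t = (P3(0 := 1 / 2)) (\<kappa> * t)" for t
  define Q4 where "Q4 t = (P4(0 := 1 / 6)) (\<kappa> * t)" for t
  have Q1: "(\<lambda>t. Q1 t - (1 - (\<kappa> * t)\<^sup>2 / 6)) \<in> o[at_right 0](\<lambda>t. t ^ 3)"
    unfolding Q1_def by (rule smallo_upd_0_compose[OF P1 _ \<kappa>]) simp
  have "(\<lambda>t. Q2 t - (1 - (\<kappa> * t)\<^sup>2 / 9)) \<in> o[at_right 0](\<lambda>t. t ^ 2)"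
    unfolding Q2_def by (rule smallo_upd_0_compose[OF P2 _ \<kappa>]) simp
  from landau_o.small.mult_left[OF this, of "\<lambda>t. lam * t"]
  have Q2: "(\<lambda>t. lam * t * (Q2 t - (1 - (\<kappa> * t)\<^sup>2 / 9))) \<in> o[at_right 0](\<lambda>t. t ^ 3)"
    using rate_pos by (simp add: mult.assoc flip: power_Suc)
  have "(\<lambda>t. Q3 t - 1 / 2) \<in> o[at_right 0](\<lambda>t. t ^ 1)"
    unfolding Q3_def by (rule smallo_upd_0_compose[OF P3 _ \<kappa>]) simp
  from landau_o.small.mult_left[OF this, of "\<lambda>t. lam\<^sup>2 * t\<^sup>2"]
  have Q3: "(\<lambda>t. lam\<^sup>2 * t\<^sup>2 * (Q3 t - 1 / 2)) \<in> o[at_right 0](\<lambda>t. t ^ 3)"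
    using rate_pos by (simp add: mult.assoc power2_eq_square power3_eq_cube)
  have "(\<lambda>t. Q4 t - 1 / 6) \<in> o[at_right 0](\<lambda>t. t ^ 0)"
    unfolding Q4_def by (rule smallo_upd_0_compose[OF P4 _ \<kappa>]) simp
  from landau_o.small.mult_left[OF this, of "\<lambda>t. lam ^ 3 * t ^ 3"]
  have Q4: "(\<lambda>t. lam ^ 3 * t ^ 3 * (Q4 t - 1 / 6)) \<in> o[at_right 0](\<lambda>t. t ^ 3)"
    using rate_pos by (simp add: mult.assoc)
  define R where "R = (\<lambda>t. exp (- lam * t) * (Q1 t + lam * t * Q2 t + lam\<^sup>2 * t\<^sup>2 * Q3 t + lam ^ 3 * t ^ 3 * Q4 t))"

  have "(\<lambda>t. (Q1 t - (1 - (\<kappa> * t)\<^sup>2 / 6)) + lam * t * (Q2 t - (1 - (\<kappa> * t)\<^sup>2 / 9)) +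
      lam\<^sup>2 * t\<^sup>2 * (Q3 t - 1 / 2) + lam ^ 3 * t ^ 3 * (Q4 t - 1 / 6)) \<in> o[at_right 0](\<lambda>t. t ^ 3)"
    by (intro sum_in_smallo Q1 Q2 Q3 Q4)
  moreover have "(\<lambda>t. exp (- lam * t)) \<in> O[at_right 0](\<lambda>_. 1)"
    by real_asymp
  ultimately have "(\<lambda>t. exp (- lam * t) * ((Q1 t - (1 - (\<kappa> * t)\<^sup>2 / 6)) + lam * t * (Q2 t - (1 - (\<kappa> * t)\<^sup>2 / 9)) +
      lam\<^sup>2 * t\<^sup>2 * (Q3 t - 1 / 2) + lam ^ 3 * t ^ 3 * (Q4 t - 1 / 6))) \<in> o[at_right 0](\<lambda>t. 1 * t ^ 3)"
    by (rule landau_o.big_small_mult[rotated])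
  from sum_in_smallo(1)[OF this[unfolded mult_1] expansion_coefficients[OF rate_pos, of \<kappa>]]
  have R: "(\<lambda>t. R t - h t) \<in> o[at_right 0](\<lambda>t. t ^ 3)"
    unfolding R_def h_def by (simp add: algebra_simps)

  \<comment> \<open>Both summands are \<open>O(t^4)\<close>, since
    \<open>1 - exp (- lam * t)\<close> is \<open>O(t)\<close>.\<close>
  define b where "b = (\<lambda>t. (\<kappa> * t) ^ 4 / 24 + (\<kappa> * t) ^ 3 * (1 - exp (- lam * t)) / 3)"
  have char_fun_le: "cmod (char_fun M (flight_position c N U t) \<alpha> - complex_of_real (h t)) \<le> b t" if "t > 0" for t
    using char_fun_flight_expansion[of t \<alpha>] that unfolding h_def b_def \<kappa>_def by simp
  have "(\<lambda>t::real. t ^ 4) \<in> o[at_right 0](\<lambda>t. t ^ 3)"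
    "(\<lambda>t::real. t ^ 3 * (1 - exp (- lam * t))) \<in> o[at_right 0](\<lambda>t. t ^ 3)"
    using rate_pos by real_asymp+
  hence "(\<lambda>t. \<kappa> ^ 4 / 24 * t ^ 4 + \<kappa> ^ 3 / 3 * (t ^ 3 * (1 - exp (- lam * t)))) \<in> o[at_right 0](\<lambda>t. t ^ 3)"
    by (intro sum_in_smallo landau_o.small.cmult_in_iff'[THEN iffD2]) auto
  hence b: "b \<in> o[at_right 0](\<lambda>t. t ^ 3)"
    by (simp add: b_def power_mult_distrib mult_ac)

  have term1: "extend_to_0 (\<lambda>\<beta>. sin (c * t * norm \<beta>) / (c * t * norm \<beta>)) \<alpha> = Q1 t" if "t > 0" for t
    using extend_to_0_radial[OF lim1, of "c * t" 1 \<alpha>] that speed_pos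
    by (simp add: P1_def Q1_def \<kappa>_def mult_ac)
  have term2: "extend_to_0 (\<lambda>\<beta>. lam / (c\<^sup>2 * t * (norm \<beta>)\<^sup>2) *
      (sin (c * t * norm \<beta>) * Si (2 * c * t * norm \<beta>) + cos (c * t * norm \<beta>) * Ci (2 * c * t * norm \<beta>))) \<alpha>
      = lam * t * Q2 t" (is "extend_to_0 ?f \<alpha> = _") if t: "t > 0" for t
  proof -
    \<comment> \<open>This also holds at \<open>\<beta> = 0\<close>, where both sides are 0 as
      quotients by 0; the extension overrides that value.\<close>
    have "?f = (\<lambda>\<beta>. lam * t * P2 (c * t * norm \<beta>))"
      using t speed_pos by (intro ext) (simp add: P2_def power_mult_distrib power2_eq_square[of t] mult.assoc)
    thus ?thesis
      using extend_to_0_radial[OF lim2, of "c * t" "lam * t" \<alpha>] t speed_pos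
      by (simp add: Q2_def \<kappa>_def mult_ac)
  qed
  have term3: "extend_to_0 (\<lambda>\<beta>. lam\<^sup>2 * t / (c * norm \<beta>) * bessel_J 1 (c * t * norm \<beta>)) \<alpha>
      = lam\<^sup>2 * t\<^sup>2 * Q3 t" (is "extend_to_0 ?f \<alpha> = _") if t: "t > 0" for t
  proof -
    have "?f = (\<lambda>\<beta>. lam\<^sup>2 * t\<^sup>2 * P3 (c * t * norm \<beta>))"
      using t speed_pos by (intro ext) (simp add: P3_def power2_eq_square[of t] mult.assoc)
    thus ?thesis
      using extend_to_0_radial[OF lim3, of "c * t" "lam\<^sup>2 * t\<^sup>2" \<alpha>] t speed_pos
      by (simp add: Q3_def \<kappa>_def mult_ac)
  qed
  have term4: "extend_to_0 (\<lambda>\<beta>. lam ^ 3 * sqrt pi * t powr (3 / 2) / (2 * c * norm \<beta>) powr (3 / 2)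
      * bessel_J (3 / 2) (c * t * norm \<beta>)) \<alpha> = lam ^ 3 * t ^ 3 * Q4 t" (is "extend_to_0 ?f \<alpha> = _")
    if t: "t > 0" for t
  proof -
    \<comment> \<open>The formula carries only \<open>t powr (3 / 2)\<close>; the other half of
      \<open>t ^ 3\<close> cancels the \<open>t\<close> in the denominator of
      \<open>P4\<close>.\<close>
    have "t ^ 3 = t powr (3 / 2) * t powr (3 / 2)"
      using t powr_realpow[of t 3] by (simp flip: powr_add)
    moreover have "(2 * (c * t * norm \<beta>)) powr (3 / 2) = t powr (3 / 2) * (2 * c * norm \<beta>) powr (3 / 2)" for \<beta> :: "real ^ 3"
      using t speed_pos powr_mult[of t "2 * c * norm \<beta>" "3 / 2"] by (simp add: mult_ac)
    ultimately have "?f = (\<lambda>\<beta>. lam ^ 3 * t ^ 3 * P4 (c * t * norm \<beta>))"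
      using t by (intro ext) (simp add: P4_def)
    thus ?thesis
      using extend_to_0_radial[OF lim4, of "c * t" "lam ^ 3 * t ^ 3" \<alpha>] t speed_pos
      by (simp add: Q4_def \<kappa>_def mult_ac)
  qed
  have main: "(\<lambda>t. char_fun M (flight_position c N U t) \<alpha> - complex_of_real (R t))
      \<in> o[at_right 0](\<lambda>t. complex_of_real (t ^ 3))"
  proof (rule smallo_complex_of_real_bound)
    show "(\<lambda>t. b t + \<bar>R t - h t\<bar>) \<in> o[at_right 0](\<lambda>t. t ^ 3)"
      using b R by (intro sum_in_smallo) auto
    have "cmod (char_fun M (flight_position c N U t) \<alpha> - complex_of_real (R t)) \<le> b t + \<bar>R t - h t\<bar>"
      if t: "0 < t" for t
    proof -
      have "cmod (char_fun M (flight_position c N U t) \<alpha> - complex_of_real (R t)) \<le>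
          cmod (char_fun M (flight_position c N U t) \<alpha> - complex_of_real (h t)) + cmod (complex_of_real (h t - R t))"
        by (rule order_trans[OF _ norm_triangle_ineq]) simp
      also have "\<dots> \<le> b t + \<bar>R t - h t\<bar>"
        using char_fun_le[OF t] by (simp only: norm_of_real abs_minus_commute)
      finally show ?thesis .
    qed
    thus "eventually (\<lambda>t. cmod (char_fun M (flight_position c N U t) \<alpha> - complex_of_real (R t))
        \<le> b t + \<bar>R t - h t\<bar>) (at_right 0)"
      by (intro eventually_mono[OF eventually_at_right_less])
  qed
  \<comment> \<open>The four terms were rewritten for \<open>t > 0\<close> only, which holds
    eventually along \<open>at_right 0\<close>.\<close>
  show ?thesis
    by (rule landau_o.small.in_cong[THEN iffD2, OF _ main], rule eventually_mono[OF eventually_at_right_less])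
       (simp only: term1 term2 term3 term4 R_def)
qed

end
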